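(* Let $A_q(G)$ be a Hopf algebra over a field of characteristic zero and let $(A_q(K),\pi)$ be a (left or right) coisotropic quantum subgroup of $A_q(G)$. If $\rho_R$ and $\rho'_R$ are equivalent right corepresentations of $A_q(K)$, then $\mathrm{ind}_K^G(\rho_R)$ and $\mathrm{ind}_K^G(\rho'_R)$ are equivalent right corepresentations of $A_q(G)$. Likewise, if $\rho_L$ and $\rho'_L$ are equivalent left corepresentations of $A_q(K)$, then $\mathrm{ind}_K^G(\rho_L)$ and $\mathrm{ind}_K^G(\rho'_L)$ are equivalent left corepresentations of $A_q(G)$.
   Context: All vector spaces are over a fixed field of characteristic zero. For a Hopf algebra $A$, a left (resp. right) coisotropic quantum subgroup of $A$ is a pair $(C,\pi)$ where $C$ is a coalgebra and a left (resp. right) $A$-module and $\pi:A\to C$ is a surjective linear map which is a coalgebra homomorphism and a left (resp. right) $A$-module homomorphism. A right (resp. left) corepresentation of a coalgebra $C$ on $V$ is a counital coassociative linear map $V\to V\otimes C$ (resp. $V\to C\otimes V$). Two corepresentations are equivalent if there is a linear isomorphism between their spaces intertwining the coactions. Let $\Delta_G$ be the coproduct of $A_q(G)$, $R=(\mathrm{id}\otimes\pi)\circ\Delta_G$ and $L=(\pi\otimes\mathrm{id})\circ\Delta_G$. For a left corepresentation $\rho_L:V\to A_q(K)\otimes V$ and a right corepresentation $\rho_R:V\to V\otimes A_q(K)$ define $$\mathrm{ind}_K^G(\rho_L)=\{F\in A_q(G)\otimes V : (R\otimes\mathrm{id})(F)=(\mathrm{id}\otimes\rho_L)(F)\},$$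 $$\mathrm{ind}_K^G(\rho_R)=\{F\in V\otimes A_q(G) : (\mathrm{id}\otimes L)(F)=(\rho_R\otimes\mathrm{id})(F)\},$$ regarded as a left corepresentation of $A_q(G)$ via $\Delta_G\otimes\mathrm{id}$ and as a right corepresentation of $A_q(G)$ via $\mathrm{id}\otimes\Delta_G$, respectively. *)

theory Defs
  imports Complex_Main "HOL-Library.Function_Algebras"
begin

section \<open>Tensor products\<close>

text \<open>
  A vector space is a type with a scalar multiplication \<open>s\<close> satisfying \<open>vector_space s\<close>, or a
  subspace \<open>V\<close> of such a type. A linear map on a subspace is represented by a map that is linear on
  the whole ambient type (over a field every linear map on a subspace extends), and only its values
  on the subspace matter.

  The tensor \<open>x \<otimes> y\<close> is realised as evaluation of bilinear forms at \<open>(x, y)\<close>, and \<open>V \<otimes> W\<close> as the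
  span of the tensors with \<open>x \<in> V\<close> and \<open>y \<in> W\<close>. Over a field this is a model of the algebraic
  tensor product; see \<open>tensor_lift_exists\<close> below for its universal property.
\<close>

type_synonym ('v, 'w, 'k) tensor = "('v \<Rightarrow> 'w \<Rightarrow> 'k) \<Rightarrow> 'k"

definition fscale :: "'k::field \<Rightarrow> ('i \<Rightarrow> 'k) \<Rightarrow> 'i \<Rightarrow> 'k" where
  "fscale c f = (\<lambda>i. c * f i)"

definition bilinear_map ::
  "('k::field \<Rightarrow> 'v::ab_group_add \<Rightarrow> 'v) \<Rightarrow> ('k \<Rightarrow> 'w::ab_group_add \<Rightarrow> 'w) \<Rightarrow>
   ('k \<Rightarrow> 'z::ab_group_add \<Rightarrow> 'z) \<Rightarrow> ('v \<Rightarrow> 'w \<Rightarrow> 'z) \<Rightarrow> bool" where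
  "bilinear_map s1 s2 s3 f \<longleftrightarrow>
     (\<forall>x. Vector_Spaces.linear s2 s3 (f x)) \<and> (\<forall>y. Vector_Spaces.linear s1 s3 (\<lambda>x. f x y))"

definition tens ::
  "('k::field \<Rightarrow> 'v::ab_group_add \<Rightarrow> 'v) \<Rightarrow> ('k \<Rightarrow> 'w::ab_group_add \<Rightarrow> 'w) \<Rightarrow>
   'v \<Rightarrow> 'w \<Rightarrow> ('v, 'w, 'k) tensor" where
  "tens s1 s2 x y = (\<lambda>B. if bilinear_map s1 s2 (*) B then B x y else 0)"

definition tensor_space ::
  "('k::field \<Rightarrow> 'v::ab_group_add \<Rightarrow> 'v) \<Rightarrow> 'v set \<Rightarrow> ('k \<Rightarrow> 'w::ab_group_add \<Rightarrow> 'w) \<Rightarrow> 'w set \<Rightarrow>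
   ('v, 'w, 'k) tensor set" where
  "tensor_space s1 V s2 W = module.span fscale {tens s1 s2 x y |x y. x \<in> V \<and> y \<in> W}"

text \<open>
  The linear map on \<open>V \<otimes> W\<close> induced by a map \<open>f\<close> that is bilinear on \<open>V \<times> W\<close>. The choice only concerns
  the values outside \<open>V \<otimes> W\<close>.
\<close>

definition tensor_lift ::
  "('k::field \<Rightarrow> 'v::ab_group_add \<Rightarrow> 'v) \<Rightarrow> 'v set \<Rightarrow> ('k \<Rightarrow> 'w::ab_group_add \<Rightarrow> 'w) \<Rightarrow> 'w set \<Rightarrow>
   ('k \<Rightarrow> 'z::ab_group_add \<Rightarrow> 'z) \<Rightarrow> ('v \<Rightarrow> 'w \<Rightarrow> 'z) \<Rightarrow> ('v, 'w, 'k) tensor \<Rightarrow> 'z" where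
  "tensor_lift s1 V s2 W s3 f =
     (SOME g. Vector_Spaces.linear fscale s3 g \<and> (\<forall>x\<in>V. \<forall>y\<in>W. g (tens s1 s2 x y) = f x y))"

definition tensor_map ::
  "('k::field \<Rightarrow> 'v::ab_group_add \<Rightarrow> 'v) \<Rightarrow> ('k \<Rightarrow> 'w::ab_group_add \<Rightarrow> 'w) \<Rightarrow>
   ('k \<Rightarrow> 'x::ab_group_add \<Rightarrow> 'x) \<Rightarrow> ('k \<Rightarrow> 'y::ab_group_add \<Rightarrow> 'y) \<Rightarrow>
   ('v \<Rightarrow> 'x) \<Rightarrow> ('w \<Rightarrow> 'y) \<Rightarrow> ('v, 'w, 'k) tensor \<Rightarrow> ('x, 'y, 'k) tensor" where
  "tensor_map s1 s2 t1 t2 f g =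
     tensor_lift s1 UNIV s2 UNIV fscale (\<lambda>x y. tens t1 t2 (f x) (g y))"

text \<open>The associativity isomorphism \<open>(x \<otimes> y) \<otimes> z \<mapsto> x \<otimes> (y \<otimes> z)\<close> and its inverse.\<close>

definition tensor_assoc ::
  "('k::field \<Rightarrow> 'u::ab_group_add \<Rightarrow> 'u) \<Rightarrow> ('k \<Rightarrow> 'v::ab_group_add \<Rightarrow> 'v) \<Rightarrow>
   ('k \<Rightarrow> 'w::ab_group_add \<Rightarrow> 'w) \<Rightarrow>
   (('u, 'v, 'k) tensor, 'w, 'k) tensor \<Rightarrow> ('u, ('v, 'w, 'k) tensor, 'k) tensor" where
  "tensor_assoc s1 s2 s3 =
     tensor_lift fscale (tensor_space s1 UNIV s2 UNIV) s3 UNIV fscale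
       (\<lambda>t z. tensor_lift s1 UNIV s2 UNIV fscale (\<lambda>x y. tens s1 fscale x (tens s2 s3 y z)) t)"

definition tensor_assoc_inv ::
  "('k::field \<Rightarrow> 'u::ab_group_add \<Rightarrow> 'u) \<Rightarrow> ('k \<Rightarrow> 'v::ab_group_add \<Rightarrow> 'v) \<Rightarrow>
   ('k \<Rightarrow> 'w::ab_group_add \<Rightarrow> 'w) \<Rightarrow>
   ('u, ('v, 'w, 'k) tensor, 'k) tensor \<Rightarrow> (('u, 'v, 'k) tensor, 'w, 'k) tensor" where
  "tensor_assoc_inv s1 s2 s3 =
     tensor_lift s1 UNIV fscale (tensor_space s2 UNIV s3 UNIV) fscale
       (\<lambda>x t. tensor_lift s2 UNIV s3 UNIV fscale (\<lambda>y z. tens fscale s3 (tens s1 s2 x y) z) t)"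


section \<open>The universal property\<close>

lemma vector_space_fscale: "vector_space (fscale :: 'k::field \<Rightarrow> ('i \<Rightarrow> 'k) \<Rightarrow> _)"
  by unfold_locales (auto simp: fscale_def fun_eq_iff algebra_simps)

lemma vector_space_times: "vector_space ((*) :: 'k::field \<Rightarrow> 'k \<Rightarrow> 'k)"
  by unfold_locales (auto simp: algebra_simps)

interpretation fs: vector_space "fscale :: 'k::field \<Rightarrow> ('i \<Rightarrow> 'k) \<Rightarrow> 'i \<Rightarrow> 'k"
  by (rule vector_space_fscale)

lemma linear_iff_hom:
  "Vector_Spaces.linear s t f \<longleftrightarrow> vector_space s \<and> vector_space t \<and>
     (\<forall>x y. f (x + y) = f x + f y) \<and> (\<forall>c x. f (s c x) = t c (f x))"
  by (auto simp: Vector_Spaces.linear_def module_hom_def module_hom_axioms_def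
      module_iff_vector_space)

lemma bilinear_tens:
  assumes "vector_space s1" "vector_space s2"
  shows "bilinear_map s1 s2 fscale (tens s1 s2)"
  using assms
  by (auto simp: bilinear_map_def tens_def linear_iff_hom vector_space_fscale fun_eq_iff fscale_def)

lemma tens_linear:
  assumes "vector_space s1" "vector_space s2"
  shows "tens s1 s2 (x + x') y = tens s1 s2 x y + tens s1 s2 x' y"
    and "tens s1 s2 x (y + y') = tens s1 s2 x y + tens s1 s2 x y'"
    and "tens s1 s2 (s1 c x) y = fscale c (tens s1 s2 x y)"
    and "tens s1 s2 x (s2 c y) = fscale c (tens s1 s2 x y)"
  using bilinear_tens[OF assms] by (auto simp: bilinear_map_def linear_iff_hom)

lemma tensor_lift_exists_UNIV:
  fixes s1 :: "'k::field \<Rightarrow> 'v::ab_group_add \<Rightarrow> 'v" and s2 :: "'k \<Rightarrow> 'w::ab_group_add \<Rightarrow> 'w"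
    and s3 :: "'k \<Rightarrow> 'z::ab_group_add \<Rightarrow> 'z"
  assumes f: "bilinear_map s1 s2 s3 f"
  shows "\<exists>g. Vector_Spaces.linear fscale s3 g \<and> (\<forall>x y. g (tens s1 s2 x y) = f x y)"
proof -
  have vs: "vector_space s1" "vector_space s2" "vector_space s3"
    using f by (auto simp: bilinear_map_def linear_iff_hom)
  interpret v1: vector_space s1 by fact
  interpret v2: vector_space s2 by fact
  interpret v3: vector_space s3 by fact
  interpret p13: vector_space_pair s1 s3
    by (intro vector_space_pair.intro vs vector_space_fscale)
  interpret p23: vector_space_pair s2 s3
    by (intro vector_space_pair.intro vs vector_space_fscale)
  interpret pf3: vector_space_pair "fscale :: 'k \<Rightarrow> ('v, 'w, 'k) tensor \<Rightarrow> _" s3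
    by (intro vector_space_pair.intro vs vector_space_fscale)
  obtain B1 where B1: "v1.independent B1" "v1.span B1 = UNIV"
    using v1.maximal_independent_subset[of UNIV] by (metis top.extremum_uniqueI)
  obtain B2 where B2: "v2.independent B2" "v2.span B2 = UNIV"
    using v2.maximal_independent_subset[of UNIV] by (metis top.extremum_uniqueI)
  define E where "E b c = (\<lambda>x y. v1.representation B1 x b * v2.representation B2 y c)" for b c
  have r1: "v1.representation B1 (x + y) b = v1.representation B1 x b + v1.representation B1 y b"
    "v1.representation B1 (s1 a x) b = a * v1.representation B1 x b" for a b x y
    by (simp_all add: v1.representation_add v1.representation_scale B1)
  have r2: "v2.representation B2 (x + y) b = v2.representation B2 x b + v2.representation B2 y b"
    "v2.representation B2 (s2 a x) b = a * v2.representation B2 x b" for a b x y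
    by (simp_all add: v2.representation_add v2.representation_scale B2)
  have E: "bilinear_map s1 s2 (*) (E b c)" for b c
    unfolding bilinear_map_def linear_iff_hom E_def r1 r2
    by (simp add: vs vector_space_times algebra_simps)
  have ev: "tens s1 s2 b' c' (E b c) = (if b' = b \<and> c' = c then 1 else 0)"
    if "b' \<in> B1" "c' \<in> B2" for b b' c c'
    unfolding tens_def using that E
    by (simp add: E_def v1.representation_basis[OF B1(1)] v2.representation_basis[OF B2(1)])
  define P where "P = (\<lambda>(b, c). tens s1 s2 b c) ` (B1 \<times> B2)"
  have inj: "inj_on (\<lambda>(b, c). tens s1 s2 b c) (B1 \<times> B2)"
  proof (intro inj_onI, clarify)
    fix b c b' c' assume bc: "b \<in> B1" "c \<in> B2" "b' \<in> B1" "c' \<in> B2"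
      and eq: "tens s1 s2 b c = tens s1 s2 b' c'"
    have "tens s1 s2 b' c' (E b c) = 1" unfolding eq[symmetric] ev[OF bc(1,2)] by simp
    then show "b = b' \<and> c = c'" unfolding ev[OF bc(3,4)] by (metis zero_neq_one)
  qed
  have "fs.independent P"
    unfolding fs.dependent_def
  proof (intro notI, elim bexE)
    fix t assume "t \<in> P" and t: "t \<in> fs.span (P - {t})"
    then obtain b c where bc: "b \<in> B1" "c \<in> B2" "t = tens s1 s2 b c" by (auto simp: P_def)
    have "fs.subspace {F :: ('v, 'w, 'k) tensor. F (E b c) = 0}"
      by (rule fs.subspaceI) (auto simp: fscale_def)
    moreover have "P - {t} \<subseteq> {F. F (E b c) = 0}"
    proof clarify
      fix u assume u: "u \<in> P" "u \<noteq> t"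
      then obtain b' c' where u': "b' \<in> B1" "c' \<in> B2" "u = tens s1 s2 b' c'" by (auto simp: P_def)
      with u(2) bc(3) have "\<not> (b' = b \<and> c' = c)" by blast
      then show "u (E b c) = 0" unfolding u'(3) ev[OF u'(1,2)] by simp
    qed
    ultimately have "t (E b c) = 0" using t fs.span_minimal by blast
    then show False unfolding bc(3) ev[OF bc(1,2)] by simp
  qed
  from pf3.linear_independent_extend[OF this, of "\<lambda>t. case_prod f (the_inv_into (B1 \<times> B2) (\<lambda>(b, c). tens s1 s2 b c) t)"]
  obtain g where g: "Vector_Spaces.linear fscale s3 g"
    and g_eq: "\<And>t. t \<in> P \<Longrightarrow> g t = case_prod f (the_inv_into (B1 \<times> B2) (\<lambda>(b, c). tens s1 s2 b c) t)"
    by blast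
  have gb: "g (tens s1 s2 b c) = f b c" if "b \<in> B1" "c \<in> B2" for b c
    using that g_eq[of "tens s1 s2 b c"] the_inv_into_f_f[OF inj, of "(b, c)"] by (auto simp: P_def)
  have bt: "bilinear_map s1 s2 fscale (tens s1 s2)" using vs by (intro bilinear_tens)
  have l1: "Vector_Spaces.linear s1 s3 (\<lambda>x. g (tens s1 s2 x y))" for y
    using g bt vs by (auto simp: bilinear_map_def linear_iff_hom)
  have l2: "Vector_Spaces.linear s2 s3 (\<lambda>y. g (tens s1 s2 x y))" for x
    using g bt vs by (auto simp: bilinear_map_def linear_iff_hom)
  have f1: "Vector_Spaces.linear s1 s3 (\<lambda>x. f x y)" and f2: "Vector_Spaces.linear s2 s3 (f x)" for x y
    using f by (auto simp: bilinear_map_def)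
  have "g (tens s1 s2 x c) = f x c" if "c \<in> B2" for x c
    using p13.linear_eq_on[OF l1 f1, of x B1 c c] that gb B1(2) by simp
  then have "g (tens s1 s2 x y) = f x y" for x y
    using p23.linear_eq_on[OF l2 f2, of y B2 x x] B2(2) by simp
  with g show ?thesis by blast
qed

lemma projection_exists:
  assumes "vector_space s" "module.subspace s S"
  shows "\<exists>p. Vector_Spaces.linear s s p \<and> (\<forall>x. p x \<in> S) \<and> (\<forall>x\<in>S. p x = x)"
proof -
  interpret vector_space s by fact
  interpret vector_space_pair s s by (intro vector_space_pair.intro assms(1))
  obtain B where B: "B \<subseteq> S" "independent B" "S \<subseteq> span B"
    using maximal_independent_subset by blast
  have sp: "span B = S" using B assms(2) span_minimal by blast
  obtain p where p: "Vector_Spaces.linear s s p" "\<forall>x\<in>B. p x = x" "range p = span ((\<lambda>x. x) ` B)"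
    using linear_independent_extend_subspace[OF B(2), of "\<lambda>x. x"] by blast
  have "p x = x" if "x \<in> S" for x
    using linear_eq_on[OF p(1) linear_id, of x B] p(2) that sp by auto
  moreover have "p x \<in> S" for x using p(3) sp by (metis image_ident rangeI)
  ultimately show ?thesis using p(1) by blast
qed

text \<open>Uniqueness on \<open>tensor_space s1 V s2 W\<close> is immediate, since that space is a span.\<close>

lemma tensor_lift_exists:
  fixes s1 :: "'k::field \<Rightarrow> 'v::ab_group_add \<Rightarrow> 'v" and s2 :: "'k \<Rightarrow> 'w::ab_group_add \<Rightarrow> 'w"
    and s3 :: "'k \<Rightarrow> 'z::ab_group_add \<Rightarrow> 'z"
  assumes vs: "vector_space s1" "vector_space s2" "vector_space s3"
    and V: "module.subspace s1 V" and W: "module.subspace s2 W"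
    and add1: "\<And>x x' y. x \<in> V \<Longrightarrow> x' \<in> V \<Longrightarrow> y \<in> W \<Longrightarrow> f (x + x') y = f x y + f x' y"
    and add2: "\<And>x y y'. x \<in> V \<Longrightarrow> y \<in> W \<Longrightarrow> y' \<in> W \<Longrightarrow> f x (y + y') = f x y + f x y'"
    and scale1: "\<And>c x y. x \<in> V \<Longrightarrow> y \<in> W \<Longrightarrow> f (s1 c x) y = s3 c (f x y)"
    and scale2: "\<And>c x y. x \<in> V \<Longrightarrow> y \<in> W \<Longrightarrow> f x (s2 c y) = s3 c (f x y)"
  shows "\<exists>g. Vector_Spaces.linear fscale s3 g \<and> (\<forall>x\<in>V. \<forall>y\<in>W. g (tens s1 s2 x y) = f x y)"
proof -
  obtain p where p: "Vector_Spaces.linear s1 s1 p" "\<And>x. p x \<in> V" "\<And>x. x \<in> V \<Longrightarrow> p x = x"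
    using projection_exists[OF vs(1) V] by blast
  obtain q where q: "Vector_Spaces.linear s2 s2 q" "\<And>x. q x \<in> W" "\<And>x. x \<in> W \<Longrightarrow> q x = x"
    using projection_exists[OF vs(2) W] by blast
  have "bilinear_map s1 s2 s3 (\<lambda>x y. f (p x) (q y))"
    using p(1,2) q(1,2) vs by (auto simp: bilinear_map_def linear_iff_hom add1 add2 scale1 scale2)
  from tensor_lift_exists_UNIV[OF this] show ?thesis using p(3) q(3) by auto
qed

lemma tensor_lift:
  assumes "\<exists>g. Vector_Spaces.linear fscale s3 g \<and> (\<forall>x\<in>V. \<forall>y\<in>W. g (tens s1 s2 x y) = f x y)"
  shows linear_tensor_lift: "Vector_Spaces.linear fscale s3 (tensor_lift s1 V s2 W s3 f)"
    and tensor_lift_tens: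
      "\<And>x y. x \<in> V \<Longrightarrow> y \<in> W \<Longrightarrow> tensor_lift s1 V s2 W s3 f (tens s1 s2 x y) = f x y"
  using someI_ex[OF assms] unfolding tensor_lift_def by auto

lemma tensor_lift_UNIV:
  assumes "bilinear_map s1 s2 s3 f"
  shows linear_tensor_lift_UNIV: "Vector_Spaces.linear fscale s3 (tensor_lift s1 UNIV s2 UNIV s3 f)"
    and tensor_lift_UNIV_tens: "tensor_lift s1 UNIV s2 UNIV s3 f (tens s1 s2 x y) = f x y"
  using tensor_lift[of s3 UNIV UNIV s1 s2 f] tensor_lift_exists_UNIV[OF assms] by auto

lemma tensor_map:
  assumes "Vector_Spaces.linear s1 t1 f" "Vector_Spaces.linear s2 t2 g"
  shows linear_tensor_map: "Vector_Spaces.linear fscale fscale (tensor_map s1 s2 t1 t2 f g)"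
    and tensor_map_tens: "tensor_map s1 s2 t1 t2 f g (tens s1 s2 x y) = tens t1 t2 (f x) (g y)"
proof -
  have "bilinear_map s1 s2 fscale (\<lambda>x y. tens t1 t2 (f x) (g y))"
    using assms bilinear_tens[of t1 t2] by (auto simp: bilinear_map_def linear_iff_hom)
  then show "Vector_Spaces.linear fscale fscale (tensor_map s1 s2 t1 t2 f g)"
    and "tensor_map s1 s2 t1 t2 f g (tens s1 s2 x y) = tens t1 t2 (f x) (g y)"
    unfolding tensor_map_def by (simp_all add: tensor_lift_UNIV)
qed

lemma subspace_tensor_space: "fs.subspace (tensor_space s1 V s2 W)"
  unfolding tensor_space_def by (rule fs.subspace_span)

lemma tens_in_tensor_space: "x \<in> V \<Longrightarrow> y \<in> W \<Longrightarrow> tens s1 s2 x y \<in> tensor_space s1 V s2 W"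
  unfolding tensor_space_def by (rule fs.span_base) blast

lemma tensor_assoc:
  fixes s1 :: "'k::field \<Rightarrow> 'u::ab_group_add \<Rightarrow> 'u" and s2 :: "'k \<Rightarrow> 'v::ab_group_add \<Rightarrow> 'v"
    and s3 :: "'k \<Rightarrow> 'w::ab_group_add \<Rightarrow> 'w"
  assumes vs: "vector_space s1" "vector_space s2" "vector_space s3"
  shows linear_tensor_assoc: "Vector_Spaces.linear fscale fscale (tensor_assoc s1 s2 s3)"
    and tensor_assoc_tens:
      "tensor_assoc s1 s2 s3 (tens fscale s3 (tens s1 s2 x y) z) = tens s1 fscale x (tens s2 s3 y z)"
proof -
  define h where "h t z = tensor_lift s1 UNIV s2 UNIV fscale
    (\<lambda>x y. tens s1 fscale x (tens s2 s3 y z)) t" for t z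
  note bt = tens_linear[OF vs(1) vector_space_fscale] tens_linear[OF vs(2,3)]
  have b: "bilinear_map s1 s2 fscale (\<lambda>x y. tens s1 fscale x (tens s2 s3 y z))" for z
    unfolding bilinear_map_def linear_iff_hom by (simp add: vs vector_space_fscale bt)
  have lin: "Vector_Spaces.linear fscale fscale (\<lambda>t. h t z)"
    and h_tens: "h (tens s1 s2 x y) z = tens s1 fscale x (tens s2 s3 y z)" for x y z
    unfolding h_def using tensor_lift_UNIV[OF b] by auto
  have lin2: "\<forall>z z' c. h t (z + z') = h t z + h t z' \<and> h t (s3 c z) = fscale c (h t z)"
    if "t \<in> tensor_space s1 UNIV s2 UNIV" for t
    using that unfolding tensor_space_def
  proof (induction rule: fs.span_induct_alt)
    case base
    have z: "h 0 z = 0" for z using module_hom.zero[of fscale fscale "\<lambda>t. h t z"] lin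
      by (auto simp: Vector_Spaces.linear_def)
    show ?case unfolding z by (simp add: fscale_def)
  next
    case (step c t u)
    then obtain x y where t: "t = tens s1 s2 x y" by auto
    have h_add: "h (F + G) z = h F z + h G z" and h_scale: "h (fscale d F) z = fscale d (h F z)"
      for d F G z using lin unfolding linear_iff_hom by blast+
    show ?case unfolding t
      by (intro allI conjI)
        (simp_all only: h_add h_scale h_tens bt step(2)[rule_format, THEN conjunct1]
          step(2)[rule_format, THEN conjunct2] fs.scale_right_distrib fs.scale_left_commute add_ac)
  qed
  have ex: "\<exists>g. Vector_Spaces.linear fscale fscale g \<and>
      (\<forall>t\<in>tensor_space s1 UNIV s2 UNIV. \<forall>z\<in>UNIV. g (tens fscale s3 t z) = h t z)"
  proof (rule tensor_lift_exists[OF vector_space_fscale vs(3) vector_space_fscale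
        subspace_tensor_space module.subspace_UNIV[OF vs(3)[folded module_iff_vector_space]]])
  qed (use lin[unfolded linear_iff_hom] lin2 in blast)+
  show "Vector_Spaces.linear fscale fscale (tensor_assoc s1 s2 s3)"
    and "tensor_assoc s1 s2 s3 (tens fscale s3 (tens s1 s2 x y) z) = tens s1 fscale x (tens s2 s3 y z)"
    using tensor_lift[OF ex] h_tens unfolding tensor_assoc_def h_def[symmetric]
    by (auto simp: tens_in_tensor_space)
qed

lemma tensor_assoc_inv:
  fixes s1 :: "'k::field \<Rightarrow> 'u::ab_group_add \<Rightarrow> 'u" and s2 :: "'k \<Rightarrow> 'v::ab_group_add \<Rightarrow> 'v"
    and s3 :: "'k \<Rightarrow> 'w::ab_group_add \<Rightarrow> 'w"
  assumes vs: "vector_space s1" "vector_space s2" "vector_space s3"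
  shows linear_tensor_assoc_inv: "Vector_Spaces.linear fscale fscale (tensor_assoc_inv s1 s2 s3)"
    and tensor_assoc_inv_tens:
      "tensor_assoc_inv s1 s2 s3 (tens s1 fscale x (tens s2 s3 y z)) = tens fscale s3 (tens s1 s2 x y) z"
proof -
  define h where "h x t = tensor_lift s2 UNIV s3 UNIV fscale
    (\<lambda>y z. tens fscale s3 (tens s1 s2 x y) z) t" for x t
  note bt = tens_linear[OF vector_space_fscale vs(3)] tens_linear[OF vs(1,2)]
  have b: "bilinear_map s2 s3 fscale (\<lambda>y z. tens fscale s3 (tens s1 s2 x y) z)" for x
    unfolding bilinear_map_def linear_iff_hom by (simp add: vs vector_space_fscale bt)
  have lin: "Vector_Spaces.linear fscale fscale (h x)"
    and h_tens: "h x (tens s2 s3 y z) = tens fscale s3 (tens s1 s2 x y) z" for x y z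
    unfolding h_def using tensor_lift_UNIV[OF b] by auto
  have lin2: "\<forall>x x' c. h (x + x') t = h x t + h x' t \<and> h (s1 c x) t = fscale c (h x t)"
    if "t \<in> tensor_space s2 UNIV s3 UNIV" for t
    using that unfolding tensor_space_def
  proof (induction rule: fs.span_induct_alt)
    case base
    have z: "h x 0 = 0" for x using module_hom.zero[of fscale fscale "h x"] lin
      by (auto simp: Vector_Spaces.linear_def)
    show ?case unfolding z by (simp add: fscale_def)
  next
    case (step c t u)
    then obtain y z where t: "t = tens s2 s3 y z" by auto
    have h_add: "h x (F + G) = h x F + h x G" and h_scale: "h x (fscale d F) = fscale d (h x F)"
      for d F G x using lin unfolding linear_iff_hom by blast+
    show ?case unfolding t
      by (intro allI conjI)
        (simp_all only: h_add h_scale h_tens bt step(2)[rule_format, THEN conjunct1]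
          step(2)[rule_format, THEN conjunct2] fs.scale_right_distrib fs.scale_left_commute add_ac)
  qed
  have ex: "\<exists>g. Vector_Spaces.linear fscale fscale g \<and>
      (\<forall>x\<in>UNIV. \<forall>t\<in>tensor_space s2 UNIV s3 UNIV. g (tens s1 fscale x t) = h x t)"
  proof (rule tensor_lift_exists[OF vs(1) vector_space_fscale vector_space_fscale
        module.subspace_UNIV[OF vs(1)[folded module_iff_vector_space]] subspace_tensor_space])
  qed (use lin[unfolded linear_iff_hom] lin2 in blast)+
  show "Vector_Spaces.linear fscale fscale (tensor_assoc_inv s1 s2 s3)"
    and "tensor_assoc_inv s1 s2 s3 (tens s1 fscale x (tens s2 s3 y z)) = tens fscale s3 (tens s1 s2 x y) z"
    using tensor_lift[OF ex] h_tens unfolding tensor_assoc_inv_def h_def[symmetric]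
    by (auto simp: tens_in_tensor_space)
qed


section \<open>Coalgebras, Hopf algebras and coisotropic quantum subgroups\<close>

locale coalgebra = vector_space s
  for s :: "'k::field \<Rightarrow> 'c::ab_group_add \<Rightarrow> 'c" +
  fixes \<Delta> :: "'c \<Rightarrow> ('c, 'c, 'k) tensor" and \<epsilon> :: "'c \<Rightarrow> 'k"
  assumes linear_comult: "Vector_Spaces.linear s fscale \<Delta>"
    and linear_counit: "Vector_Spaces.linear s (*) \<epsilon>"
    and comult_in: "\<Delta> x \<in> tensor_space s UNIV s UNIV"
    and coassoc: "tensor_assoc s s s (tensor_map s s fscale s \<Delta> id (\<Delta> x)) =
      tensor_map s s s fscale id \<Delta> (\<Delta> x)"
    and counit_left: "tensor_map s s (*) s \<epsilon> id (\<Delta> x) = tens (*) s 1 x"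
    and counit_right: "tensor_map s s s (*) id \<epsilon> (\<Delta> x) = tens s (*) x 1"

text \<open>
  The class \<^class>\<open>ring_1\<close> demands \<open>0 \<noteq> 1\<close>; this is no restriction, since \<open>\<epsilon> 1 = 1\<close> excludes the zero
  algebra.
\<close>

definition tensor_mult ::
  "('k::field \<Rightarrow> 'a::ring_1 \<Rightarrow> 'a) \<Rightarrow>
   ('a, 'a, 'k) tensor \<Rightarrow> ('a, 'a, 'k) tensor \<Rightarrow> ('a, 'a, 'k) tensor" where
  "tensor_mult s F G =
     tensor_lift s UNIV s UNIV fscale
       (\<lambda>a b. tensor_lift s UNIV s UNIV fscale (\<lambda>c d. tens s s (a * c) (b * d)) G) F"

locale hopf_algebra = coalgebra s \<Delta> \<epsilon>
  for s :: "'k::field \<Rightarrow> 'a::ring_1 \<Rightarrow> 'a" and \<Delta> \<epsilon> +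
  fixes S :: "'a \<Rightarrow> 'a"
  assumes bilinear_mult: "bilinear_map s s s (*)"
    and comult_mult: "\<Delta> (a * b) = tensor_mult s (\<Delta> a) (\<Delta> b)"
    and comult_one: "\<Delta> 1 = tens s s 1 1"
    and counit_mult: "\<epsilon> (a * b) = \<epsilon> a * \<epsilon> b"
    and counit_one: "\<epsilon> 1 = 1"
    and linear_antipode: "Vector_Spaces.linear s s S"
    and antipode_left:
      "tensor_lift s UNIV s UNIV s (*) (tensor_map s s s s S id (\<Delta> a)) = s (\<epsilon> a) 1"
    and antipode_right:
      "tensor_lift s UNIV s UNIV s (*) (tensor_map s s s s id S (\<Delta> a)) = s (\<epsilon> a) 1"

locale coalgebra_epimorphism = A: coalgebra sA \<Delta>A \<epsilon>A + C: coalgebra sC \<Delta>C \<epsilon>C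
  for sA :: "'k::field \<Rightarrow> 'a::ab_group_add \<Rightarrow> 'a" and \<Delta>A \<epsilon>A
    and sC :: "'k \<Rightarrow> 'c::ab_group_add \<Rightarrow> 'c" and \<Delta>C \<epsilon>C +
  fixes \<pi> :: "'a \<Rightarrow> 'c"
  assumes linear_proj: "Vector_Spaces.linear sA sC \<pi>"
    and surj_proj: "surj \<pi>"
    and comult_proj: "\<Delta>C (\<pi> a) = tensor_map sA sA sC sC \<pi> \<pi> (\<Delta>A a)"
    and counit_proj: "\<epsilon>C (\<pi> a) = \<epsilon>A a"

locale left_coisotropic_subgroup =
  hopf_algebra sA \<Delta>A \<epsilon>A S + coalgebra_epimorphism sA \<Delta>A \<epsilon>A sC \<Delta>C \<epsilon>C \<pi>
  for sA :: "'k::field \<Rightarrow> 'a::ring_1 \<Rightarrow> 'a" and \<Delta>A \<epsilon>A S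
    and sC :: "'k \<Rightarrow> 'c::ab_group_add \<Rightarrow> 'c" and \<Delta>C \<epsilon>C \<pi> +
  fixes act :: "'a \<Rightarrow> 'c \<Rightarrow> 'c"
  assumes bilinear_act: "bilinear_map sA sC sC act"
    and act_one: "act 1 c = c"
    and act_mult: "act (a * b) c = act a (act b c)"
    and proj_mult: "\<pi> (a * b) = act a (\<pi> b)"

locale right_coisotropic_subgroup =
  hopf_algebra sA \<Delta>A \<epsilon>A S + coalgebra_epimorphism sA \<Delta>A \<epsilon>A sC \<Delta>C \<epsilon>C \<pi>
  for sA :: "'k::field \<Rightarrow> 'a::ring_1 \<Rightarrow> 'a" and \<Delta>A \<epsilon>A S
    and sC :: "'k \<Rightarrow> 'c::ab_group_add \<Rightarrow> 'c" and \<Delta>C \<epsilon>C \<pi> +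
  fixes act :: "'c \<Rightarrow> 'a \<Rightarrow> 'c"
  assumes bilinear_act: "bilinear_map sC sA sC act"
    and act_one: "act c 1 = c"
    and act_mult: "act c (a * b) = act (act c a) b"
    and proj_mult: "\<pi> (a * b) = act (\<pi> a) b"


section \<open>Corepresentations\<close>

record ('k, 'v, 't) corep =
  scalar :: "'k \<Rightarrow> 'v \<Rightarrow> 'v"
  carrier :: "'v set"
  coaction :: "'v \<Rightarrow> 't"

definition right_corepresentation ::
  "('k::field \<Rightarrow> 'c::ab_group_add \<Rightarrow> 'c) \<Rightarrow> ('c \<Rightarrow> ('c, 'c, 'k) tensor) \<Rightarrow> ('c \<Rightarrow> 'k) \<Rightarrow>
   ('k, 'v::ab_group_add, ('v, 'c, 'k) tensor) corep \<Rightarrow> bool" where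
  "right_corepresentation sC \<Delta> \<epsilon> \<rho> \<longleftrightarrow>
     vector_space (scalar \<rho>) \<and> module.subspace (scalar \<rho>) (carrier \<rho>) \<and>
     Vector_Spaces.linear (scalar \<rho>) fscale (coaction \<rho>) \<and>
     (\<forall>v\<in>carrier \<rho>.
        coaction \<rho> v \<in> tensor_space (scalar \<rho>) (carrier \<rho>) sC UNIV \<and>
        tensor_assoc (scalar \<rho>) sC sC
            (tensor_map (scalar \<rho>) sC fscale sC (coaction \<rho>) id (coaction \<rho> v)) =
          tensor_map (scalar \<rho>) sC (scalar \<rho>) fscale id \<Delta> (coaction \<rho> v) \<and>
        tensor_map (scalar \<rho>) sC (scalar \<rho>) (*) id \<epsilon> (coaction \<rho> v) = tens (scalar \<rho>) (*) v 1)"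

definition left_corepresentation ::
  "('k::field \<Rightarrow> 'c::ab_group_add \<Rightarrow> 'c) \<Rightarrow> ('c \<Rightarrow> ('c, 'c, 'k) tensor) \<Rightarrow> ('c \<Rightarrow> 'k) \<Rightarrow>
   ('k, 'v::ab_group_add, ('c, 'v, 'k) tensor) corep \<Rightarrow> bool" where
  "left_corepresentation sC \<Delta> \<epsilon> \<rho> \<longleftrightarrow>
     vector_space (scalar \<rho>) \<and> module.subspace (scalar \<rho>) (carrier \<rho>) \<and>
     Vector_Spaces.linear (scalar \<rho>) fscale (coaction \<rho>) \<and>
     (\<forall>v\<in>carrier \<rho>.
        coaction \<rho> v \<in> tensor_space sC UNIV (scalar \<rho>) (carrier \<rho>) \<and>
        tensor_assoc sC sC (scalar \<rho>)
            (tensor_map sC (scalar \<rho>) fscale (scalar \<rho>) \<Delta> id (coaction \<rho> v)) =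
          tensor_map sC (scalar \<rho>) sC fscale id (coaction \<rho>) (coaction \<rho> v) \<and>
        tensor_map sC (scalar \<rho>) (*) (scalar \<rho>) \<epsilon> id (coaction \<rho> v) = tens (*) (scalar \<rho>) 1 v)"

definition equivalent_right_coreps ::
  "('k::field \<Rightarrow> 'c::ab_group_add \<Rightarrow> 'c) \<Rightarrow> ('c \<Rightarrow> ('c, 'c, 'k) tensor) \<Rightarrow> ('c \<Rightarrow> 'k) \<Rightarrow>
   ('k, 'v::ab_group_add, ('v, 'c, 'k) tensor) corep \<Rightarrow>
   ('k, 'w::ab_group_add, ('w, 'c, 'k) tensor) corep \<Rightarrow> bool" where
  "equivalent_right_coreps sC \<Delta> \<epsilon> \<rho> \<rho>' \<longleftrightarrow>
     right_corepresentation sC \<Delta> \<epsilon> \<rho> \<and> right_corepresentation sC \<Delta> \<epsilon> \<rho>' \<and>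
     (\<exists>T. Vector_Spaces.linear (scalar \<rho>) (scalar \<rho>') T \<and> bij_betw T (carrier \<rho>) (carrier \<rho>') \<and>
        (\<forall>v\<in>carrier \<rho>.
           coaction \<rho>' (T v) = tensor_map (scalar \<rho>) sC (scalar \<rho>') sC T id (coaction \<rho> v)))"

definition equivalent_left_coreps ::
  "('k::field \<Rightarrow> 'c::ab_group_add \<Rightarrow> 'c) \<Rightarrow> ('c \<Rightarrow> ('c, 'c, 'k) tensor) \<Rightarrow> ('c \<Rightarrow> 'k) \<Rightarrow>
   ('k, 'v::ab_group_add, ('c, 'v, 'k) tensor) corep \<Rightarrow>
   ('k, 'w::ab_group_add, ('c, 'w, 'k) tensor) corep \<Rightarrow> bool" where
  "equivalent_left_coreps sC \<Delta> \<epsilon> \<rho> \<rho>' \<longleftrightarrow>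
     left_corepresentation sC \<Delta> \<epsilon> \<rho> \<and> left_corepresentation sC \<Delta> \<epsilon> \<rho>' \<and>
     (\<exists>T. Vector_Spaces.linear (scalar \<rho>) (scalar \<rho>') T \<and> bij_betw T (carrier \<rho>) (carrier \<rho>') \<and>
        (\<forall>v\<in>carrier \<rho>.
           coaction \<rho>' (T v) = tensor_map sC (scalar \<rho>) sC (scalar \<rho>') id T (coaction \<rho> v)))"


section \<open>Induced corepresentations\<close>

text \<open>
  Both sides of the defining condition are compared in \<open>V \<otimes> (C \<otimes> A)\<close>, respectively
  \<open>A \<otimes> (C \<otimes> V)\<close>. The coactions \<open>id \<otimes> \<Delta>A\<close> and \<open>\<Delta>A \<otimes> id\<close> are reassociated so as to take values in
  \<open>(V \<otimes> A) \<otimes> A\<close> and \<open>A \<otimes> (A \<otimes> V)\<close>.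
\<close>

definition ind_right ::
  "('k::field \<Rightarrow> 'a::ab_group_add \<Rightarrow> 'a) \<Rightarrow> ('a \<Rightarrow> ('a, 'a, 'k) tensor) \<Rightarrow>
   ('k \<Rightarrow> 'c::ab_group_add \<Rightarrow> 'c) \<Rightarrow> ('a \<Rightarrow> 'c) \<Rightarrow>
   ('k, 'v::ab_group_add, ('v, 'c, 'k) tensor) corep \<Rightarrow>
   ('k, ('v, 'a, 'k) tensor, (('v, 'a, 'k) tensor, 'a, 'k) tensor) corep" where
  "ind_right sA \<Delta>A sC \<pi> \<rho> =
     (let sV = scalar \<rho>; L = tensor_map sA sA sC sA \<pi> id \<circ> \<Delta>A in
      \<lparr>scalar = fscale,
       carrier = {F \<in> tensor_space sV (carrier \<rho>) sA UNIV.
         tensor_map sV sA sV fscale id L F =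
         tensor_assoc sV sC sA (tensor_map sV sA fscale sA (coaction \<rho>) id F)},
       coaction = tensor_assoc_inv sV sA sA \<circ> tensor_map sV sA sV fscale id \<Delta>A\<rparr>)"

definition ind_left ::
  "('k::field \<Rightarrow> 'a::ab_group_add \<Rightarrow> 'a) \<Rightarrow> ('a \<Rightarrow> ('a, 'a, 'k) tensor) \<Rightarrow>
   ('k \<Rightarrow> 'c::ab_group_add \<Rightarrow> 'c) \<Rightarrow> ('a \<Rightarrow> 'c) \<Rightarrow>
   ('k, 'v::ab_group_add, ('c, 'v, 'k) tensor) corep \<Rightarrow>
   ('k, ('a, 'v, 'k) tensor, ('a, ('a, 'v, 'k) tensor, 'k) tensor) corep" where
  "ind_left sA \<Delta>A sC \<pi> \<rho> =
     (let sV = scalar \<rho>; R = tensor_map sA sA sA sC id \<pi> \<circ> \<Delta>A in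
      \<lparr>scalar = fscale,
       carrier = {F \<in> tensor_space sA UNIV sV (carrier \<rho>).
         tensor_assoc sA sC sV (tensor_map sA sV fscale sV R id F) =
         tensor_map sA sV sA fscale id (coaction \<rho>) F},
       coaction = tensor_assoc sA sA sV \<circ> tensor_map sA sV fscale sV \<Delta>A id\<rparr>)"

end

theory Submission
  imports Defs
begin

text \<open>
  An equivalence \<open>T : V \<rightarrow> V'\<close> of right corepresentations should induce \<open>T \<otimes> id\<close> on
  \<open>V \<otimes> A\<close>. The space of the induced corepresentation is the equalizer of two linear maps
  \<open>V \<otimes> A \<rightarrow> V \<otimes> (C \<otimes> A)\<close>: translation \<open>id \<otimes> L\<close>, which touches only the factor \<open>A\<close>, and
  \<open>\<rho> \<otimes> id\<close>, which touches only the factor \<open>V\<close>. The first commutes with \<open>T \<otimes> id\<close> trivially, the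
  second because \<open>T\<close> intertwines the coactions, so \<open>T \<otimes> id\<close> maps one equalizer into the other
  (\<open>right_intertwiner_maps_ind\<close>). The inverse of \<open>T\<close> is an intertwiner too, and it gives the
  inverse map. Finally \<open>T \<otimes> id\<close> commutes with \<open>id \<otimes> \<Delta>\<close>, again because the two act on different
  factors (\<open>right_intertwiner_ind_coaction\<close>).

  Equivalence also asserts that the two induced objects are corepresentations at all, and here lies
  the substance. Coassociativity and the counit law come from those of \<open>A\<close>. What has to be shown is
  that \<open>id \<otimes> \<Delta>\<close> maps the equalizer \<open>I\<close> into \<open>I \<otimes> A\<close> and not merely into \<open>(V \<otimes> A) \<otimes> A\<close>. There
  are two ingredients. Since a vector space is flat, an element of \<open>W \<otimes> U\<close> on which \<open>P \<otimes> id\<close> and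
  \<open>Q \<otimes> id\<close> agree lies in \<open>{w \<in> W. P w = Q w} \<otimes> U\<close> (\<open>tensor_equalizer_left_factor\<close>). And both
  defining maps commute with the comultiplication of the last factor
  (\<open>by_translation_ind_coaction\<close>, \<open>by_coaction_ind_coaction\<close>): for \<open>id \<otimes> L\<close> this says that
  \<open>L = (\<pi> \<otimes> id) \<circ> \<Delta>\<close> is a map of right \<open>A\<close>-comodules, which is the coassociativity of \<open>\<Delta>\<close>
  (\<open>left_translation_comult\<close>).

  Left corepresentations are treated by the mirror image of this argument. All identities between
  maps on tensor products are checked on pure tensors.
\<close>


section \<open>Linear maps out of tensor products\<close>

text \<open>
  Rules that prove linearity of a map \<open>x \<mapsto> e x\<close> by descending through the term \<open>e\<close>; the rule
  for a linear operator is therefore stated for its composition with an arbitrary linear map.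
\<close>

named_theorems lin_intros

lemma linear_vector_spaces:
  assumes "Vector_Spaces.linear s t f"
  shows "vector_space s" "vector_space t"
  using assms by (auto simp: linear_iff_hom)

lemma linear_comp:
  assumes "Vector_Spaces.linear t u f" "Vector_Spaces.linear s t h"
  shows "Vector_Spaces.linear s u (\<lambda>x. f (h x))"
  using assms by (auto simp: linear_iff_hom)

lemma linear_ident [lin_intros]:
  assumes "vector_space s"
  shows "Vector_Spaces.linear s s (\<lambda>x. x)"
  using assms by (auto simp: linear_iff_hom)

lemma linear_id [lin_intros]:
  assumes "vector_space s"
  shows "Vector_Spaces.linear s s id"
  using assms by (auto simp: linear_iff_hom)

lemma linear_minus_map:
  assumes "Vector_Spaces.linear s t f" "Vector_Spaces.linear s t g"
  shows "Vector_Spaces.linear s t (\<lambda>x. f x - g x)"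
proof -
  interpret vector_space t by (rule linear_vector_spaces[OF assms(1)])
  show ?thesis using assms by (auto simp: linear_iff_hom scale_right_diff_distrib)
qed

lemma linear_tens_left [lin_intros]:
  assumes "vector_space s2" "Vector_Spaces.linear s s1 h"
  shows "Vector_Spaces.linear s fscale (\<lambda>x. tens s1 s2 (h x) y)"
  using assms tens_linear[of s1 s2] vector_space_fscale by (auto simp: linear_iff_hom)

lemma linear_tens_right [lin_intros]:
  assumes "vector_space s1" "Vector_Spaces.linear s s2 h"
  shows "Vector_Spaces.linear s fscale (\<lambda>y. tens s1 s2 x (h y))"
  using assms tens_linear[of s1 s2] vector_space_fscale by (auto simp: linear_iff_hom)

lemmas [lin_intros] =
  vector_space_fscale vector_space_times
  linear_comp[OF linear_tensor_map]
  linear_comp[OF linear_tensor_assoc]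
  linear_comp[OF linear_tensor_assoc_inv]

lemmas tens_simps = tensor_map_tens tensor_assoc_tens tensor_assoc_inv_tens

text \<open>
  Two linear maps agree on a span as soon as they agree on the generators, here the pure tensors.
  The conclusion quantifies over \<open>X\<close> so that, in backward reasoning, \<open>f\<close> and \<open>g\<close> can be read off
  from the two sides as functions of a bound variable.
\<close>

lemma tensor_space_ext:
  fixes s1 :: "'k::field \<Rightarrow> 'v::ab_group_add \<Rightarrow> 'v" and s2 :: "'k \<Rightarrow> 'w::ab_group_add \<Rightarrow> 'w"
    and f g :: "('v, 'w, 'k) tensor \<Rightarrow> 'i \<Rightarrow> 'k"
  assumes f: "Vector_Spaces.linear fscale fscale f" and g: "Vector_Spaces.linear fscale fscale g"
    and eq: "\<And>x y. x \<in> V \<Longrightarrow> y \<in> W \<Longrightarrow> f (tens s1 s2 x y) = g (tens s1 s2 x y)"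
  shows "\<forall>X\<in>tensor_space s1 V s2 W. f X = g X"
proof
  fix X assume X: "X \<in> tensor_space s1 V s2 W"
  interpret vector_space_pair "fscale :: 'k \<Rightarrow> ('v, 'w, 'k) tensor \<Rightarrow> _"
    "fscale :: 'k \<Rightarrow> ('i \<Rightarrow> 'k) \<Rightarrow> _"
    by (intro vector_space_pair.intro vector_space_fscale)
  show "f X = g X"
    by (rule linear_eq_on[OF f g X[unfolded tensor_space_def]]) (use eq in auto)
qed

lemma tensor_space_left_nested_ext:
  assumes f: "Vector_Spaces.linear fscale fscale f" and g: "Vector_Spaces.linear fscale fscale g"
    and s3: "vector_space s3"
    and eq: "\<And>x y z. x \<in> U \<Longrightarrow> y \<in> V \<Longrightarrow> z \<in> W \<Longrightarrow>
      f (tens fscale s3 (tens s1 s2 x y) z) = g (tens fscale s3 (tens s1 s2 x y) z)"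
  shows "\<forall>X\<in>tensor_space fscale (tensor_space s1 U s2 V) s3 W. f X = g X"
proof (rule tensor_space_ext[OF f g])
  fix t z assume t: "t \<in> tensor_space s1 U s2 V" and z: "z \<in> W"
  have "\<forall>t\<in>tensor_space s1 U s2 V. f (tens fscale s3 t z) = g (tens fscale s3 t z)"
  proof (rule tensor_space_ext[OF linear_comp[OF f] linear_comp[OF g]])
  qed ((intro lin_intros s3)+, use eq z in blast)
  then show "f (tens fscale s3 t z) = g (tens fscale s3 t z)" using t by blast
qed

lemma linear_maps_tensor_space:
  assumes h: "Vector_Spaces.linear fscale s h" and Z: "module.subspace s Z"
    and X: "X \<in> tensor_space s1 V s2 W"
    and im: "\<And>x y. x \<in> V \<Longrightarrow> y \<in> W \<Longrightarrow> h (tens s1 s2 x y) \<in> Z"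
  shows "h X \<in> Z"
proof -
  interpret vector_space s using h by (rule linear_vector_spaces)
  interpret h: Vector_Spaces.linear fscale s h by (rule h)
  show ?thesis
    using X unfolding tensor_space_def
  proof (induction rule: fs.span_induct_alt)
    case base show ?case unfolding h.zero by (rule subspace_0[OF Z])
  next
    case (step c t u)
    then obtain x y where t: "t = tens s1 s2 x y" "x \<in> V" "y \<in> W" by blast
    show ?case
      unfolding h.add h.scale t by (intro subspace_add[OF Z] subspace_scale[OF Z] im t step.IH)
  qed
qed

lemma tensor_map_maps_tensor_space:
  assumes "Vector_Spaces.linear s1 t1 f" "Vector_Spaces.linear s2 t2 g"
    and "X \<in> tensor_space s1 V s2 W"
    and "\<And>x. x \<in> V \<Longrightarrow> f x \<in> V'" "\<And>y. y \<in> W \<Longrightarrow> g y \<in> W'"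
  shows "tensor_map s1 s2 t1 t2 f g X \<in> tensor_space t1 V' t2 W'"
  by (rule linear_maps_tensor_space[OF _ subspace_tensor_space assms(3)])
    (auto simp: tensor_map_tens[OF assms(1,2)] intro!: tens_in_tensor_space assms linear_tensor_map)

lemma subspace_equalizer:
  assumes P: "Vector_Spaces.linear s t P" and Q: "Vector_Spaces.linear s t Q"
    and W: "module.subspace s W"
  shows "module.subspace s {w \<in> W. P w = Q w}"
proof -
  interpret vector_space s using P by (rule linear_vector_spaces)
  interpret P: Vector_Spaces.linear s t P by (rule P)
  interpret Q: Vector_Spaces.linear s t Q by (rule Q)
  show ?thesis
    by (rule subspaceI)
      (auto simp: P.zero Q.zero P.add Q.add P.scale Q.scale
        intro: subspace_0[OF W] subspace_add[OF W] subspace_scale[OF W])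
qed

text \<open>
  Over a field the map \<open>P - Q\<close> splits on \<open>W\<close>: with a linear section \<open>\<sigma>\<close>,
  \<open>p w = w - \<sigma> (P w - Q w)\<close> defines a projection of \<open>W\<close> onto the equalizer of \<open>P\<close> and \<open>Q\<close>. By this
  formula, \<open>p \<otimes> id\<close> can be expressed through \<open>P \<otimes> id\<close> and \<open>Q \<otimes> id\<close>.
\<close>

lemma equalizer_projection:
  assumes P: "Vector_Spaces.linear s t P" and Q: "Vector_Spaces.linear s t Q"
    and W: "module.subspace s W"
  shows "\<exists>\<sigma>. Vector_Spaces.linear t s \<sigma> \<and> (\<forall>w\<in>W. w - \<sigma> (P w - Q w) \<in> {w \<in> W. P w = Q w})"
proof -
  have vs: "vector_space s" "vector_space t" using linear_vector_spaces[OF P] by auto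
  interpret vector_space s by fact
  interpret vector_space_pair s t by (intro vector_space_pair.intro vs)
  interpret P: Vector_Spaces.linear s t P by (rule P)
  interpret Q: Vector_Spaces.linear s t Q by (rule Q)
  obtain \<sigma> where \<sigma>: "range \<sigma> \<subseteq> W" "Vector_Spaces.linear t s \<sigma>"
    "\<And>v. v \<in> (\<lambda>w. P w - Q w) ` W \<Longrightarrow> P (\<sigma> v) - Q (\<sigma> v) = v"
    using linear_exists_right_inverse_on[OF linear_minus_map[OF P Q] W] by blast
  have "w - \<sigma> (P w - Q w) \<in> {w \<in> W. P w = Q w}" if w: "w \<in> W" for w
  proof -
    have "w - \<sigma> (P w - Q w) \<in> W"
      using \<sigma>(1) w by (intro subspace_diff[OF W]) auto
    moreover have "P (w - \<sigma> (P w - Q w)) - Q (w - \<sigma> (P w - Q w)) = 0"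
      using \<sigma>(3)[of "P w - Q w"] w by (simp add: P.diff Q.diff algebra_simps)
    ultimately show ?thesis by simp
  qed
  with \<sigma>(2) show ?thesis by blast
qed

text \<open>
  Tensoring with a vector space preserves equalizers. If \<open>p\<close> is the projection
  \<open>w \<mapsto> w - \<sigma> (P w - Q w)\<close> onto the equalizer, then
  \<open>(p \<otimes> id) X = X - (\<sigma> \<otimes> id) ((P \<otimes> id) X - (Q \<otimes> id) X)\<close>. The hypothesis makes the correction
  term vanish, so \<open>X = (p \<otimes> id) X\<close>, and this lies in the tensor product with the image of \<open>p\<close>.
\<close>

lemma tensor_equalizer_left_factor:
  assumes P: "Vector_Spaces.linear s t P" and Q: "Vector_Spaces.linear s t Q"
    and W: "module.subspace s W" and u: "vector_space u"
    and X: "X \<in> tensor_space s W u U"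
    and eq: "tensor_map s u t u P id X = tensor_map s u t u Q id X"
  shows "X \<in> tensor_space s {w \<in> W. P w = Q w} u U"
proof -
  obtain \<sigma> where \<sigma>: "Vector_Spaces.linear t s \<sigma>"
    and in_eq: "\<And>w. w \<in> W \<Longrightarrow> w - \<sigma> (P w - Q w) \<in> {w \<in> W. P w = Q w}"
    using equalizer_projection[OF P Q W] by blast
  note vs = linear_vector_spaces[OF P] u
  note lins = P Q \<sigma> linear_comp[OF \<sigma> linear_minus_map[OF P Q]]
  have proj: "Vector_Spaces.linear s s (\<lambda>w. w - \<sigma> (P w - Q w))"
    by (intro linear_minus_map[OF linear_ident] lins vs)
  note tl = tens_linear[OF vs(1,3)] tens_linear[OF vs(2,3)]
  have tens_diff: "tens s u (x - x') y = tens s u x y - tens s u x' y"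
    "tens t u (z - z') y = tens t u z y - tens t u z' y" for x x' z z' y
    using tl(1)[of "x - x'" x' y] tl(5)[of "z - z'" z' y] by (simp_all add: algebra_simps)
  have "\<forall>X\<in>tensor_space s W u U. tensor_map s u s u (\<lambda>w. w - \<sigma> (P w - Q w)) id X =
      X - tensor_map t u s u \<sigma> id (tensor_map s u t u P id X - tensor_map s u t u Q id X)"
  proof (rule tensor_space_ext)
    fix x y
    show "tensor_map s u s u (\<lambda>w. w - \<sigma> (P w - Q w)) id (tens s u x y) =
        tens s u x y - tensor_map t u s u \<sigma> id
          (tensor_map s u t u P id (tens s u x y) - tensor_map s u t u Q id (tens s u x y))"
      \<comment> \<open>Read from right to left, the second rule makes the argument of \<open>\<sigma>\<close> a single pure tensor.\<close>
      by (simp add: tens_simps P Q \<sigma> proj linear_id vs tens_diff flip: tens_diff(2))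
  next
    show "Vector_Spaces.linear fscale fscale (tensor_map s u s u (\<lambda>w. w - \<sigma> (P w - Q w)) id)"
      by (intro linear_tensor_map lin_intros vs proj)
  next
    show "Vector_Spaces.linear fscale fscale (\<lambda>X. X - tensor_map t u s u \<sigma> id
        (tensor_map s u t u P id X - tensor_map s u t u Q id X))"
      by (intro linear_minus_map lin_intros lins vs)
  qed
  then have "tensor_map s u s u (\<lambda>w. w - \<sigma> (P w - Q w)) id X =
      X - tensor_map t u s u \<sigma> id (tensor_map s u t u P id X - tensor_map s u t u Q id X)"
    using X by blast
  also have "\<dots> = X"
    using eq module_hom.zero[of fscale fscale "tensor_map t u s u \<sigma> id"]
      linear_tensor_map[OF \<sigma> linear_id[OF u]]
    by (simp add: Vector_Spaces.linear_def)
  finally have "X = tensor_map s u s u (\<lambda>w. w - \<sigma> (P w - Q w)) id X" by simp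
  also have "\<dots> \<in> tensor_space s {w \<in> W. P w = Q w} u U"
    by (rule tensor_map_maps_tensor_space[OF proj linear_id[OF u] X in_eq]) auto
  finally show ?thesis .
qed

lemma tensor_equalizer_right_factor:
  assumes P: "Vector_Spaces.linear s t P" and Q: "Vector_Spaces.linear s t Q"
    and W: "module.subspace s W" and u: "vector_space u"
    and X: "X \<in> tensor_space u U s W"
    and eq: "tensor_map u s u t id P X = tensor_map u s u t id Q X"
  shows "X \<in> tensor_space u U s {w \<in> W. P w = Q w}"
proof -
  obtain \<sigma> where \<sigma>: "Vector_Spaces.linear t s \<sigma>"
    and in_eq: "\<And>w. w \<in> W \<Longrightarrow> w - \<sigma> (P w - Q w) \<in> {w \<in> W. P w = Q w}"
    using equalizer_projection[OF P Q W] by blast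
  note vs = linear_vector_spaces[OF P] u
  note lins = P Q \<sigma> linear_comp[OF \<sigma> linear_minus_map[OF P Q]]
  have proj: "Vector_Spaces.linear s s (\<lambda>w. w - \<sigma> (P w - Q w))"
    by (intro linear_minus_map[OF linear_ident] lins vs)
  note tl = tens_linear[OF vs(3,1)] tens_linear[OF vs(3,2)]
  have tens_diff: "tens u s x (y - y') = tens u s x y - tens u s x y'"
    "tens u t x (z - z') = tens u t x z - tens u t x z'" for x y y' z z'
    using tl(2)[of x "y - y'" y'] tl(6)[of x "z - z'" z'] by (simp_all add: algebra_simps)
  have "\<forall>X\<in>tensor_space u U s W. tensor_map u s u s id (\<lambda>w. w - \<sigma> (P w - Q w)) X =
      X - tensor_map u t u s id \<sigma> (tensor_map u s u t id P X - tensor_map u s u t id Q X)"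
  proof (rule tensor_space_ext)
    fix x y
    show "tensor_map u s u s id (\<lambda>w. w - \<sigma> (P w - Q w)) (tens u s x y) =
        tens u s x y - tensor_map u t u s id \<sigma>
          (tensor_map u s u t id P (tens u s x y) - tensor_map u s u t id Q (tens u s x y))"
      \<comment> \<open>Read from right to left, the second rule makes the argument of \<open>\<sigma>\<close> a single pure tensor.\<close>
      by (simp add: tens_simps P Q \<sigma> proj linear_id vs tens_diff flip: tens_diff(2))
  next
    show "Vector_Spaces.linear fscale fscale (tensor_map u s u s id (\<lambda>w. w - \<sigma> (P w - Q w)))"
      by (intro linear_tensor_map lin_intros vs proj)
  next
    show "Vector_Spaces.linear fscale fscale (\<lambda>X. X - tensor_map u t u s id \<sigma>
        (tensor_map u s u t id P X - tensor_map u s u t id Q X))"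
      by (intro linear_minus_map lin_intros lins vs)
  qed
  then have "tensor_map u s u s id (\<lambda>w. w - \<sigma> (P w - Q w)) X =
      X - tensor_map u t u s id \<sigma> (tensor_map u s u t id P X - tensor_map u s u t id Q X)"
    using X by blast
  also have "\<dots> = X"
    using eq module_hom.zero[of fscale fscale "tensor_map u t u s id \<sigma>"]
      linear_tensor_map[OF linear_id[OF u] \<sigma>]
    by (simp add: Vector_Spaces.linear_def)
  finally have "X = tensor_map u s u s id (\<lambda>w. w - \<sigma> (P w - Q w)) X" by simp
  also have "\<dots> \<in> tensor_space u U s {w \<in> W. P w = Q w}"
    by (rule tensor_map_maps_tensor_space[OF linear_id[OF u] proj X _ in_eq]) auto
  finally show ?thesis .
qed

text \<open>
  A linear map that is bijective only between two subspaces still has an inverse that is linear on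
  the whole ambient space, since a linear map on a subspace extends.
\<close>

lemma linear_bij_betw_inverse:
  assumes T: "Vector_Spaces.linear s t T" and V: "module.subspace s V" and bij: "bij_betw T V W"
  shows "\<exists>g. Vector_Spaces.linear t s g \<and>
    (\<forall>v\<in>V. g (T v) = v) \<and> (\<forall>w\<in>W. g w \<in> V) \<and> (\<forall>w\<in>W. T (g w) = w)"
proof -
  interpret vector_space_pair s t
    by (intro vector_space_pair.intro linear_vector_spaces[OF T])
  obtain g where "Vector_Spaces.linear t s g" "\<forall>v\<in>V. g (T v) = v"
    using linear_exists_left_inverse_on[OF T V] bij by (auto simp: bij_betw_def)
  then show ?thesis using bij by (auto simp: bij_betw_def)
qed

lemma tensor_map_inverse:
  assumes f: "Vector_Spaces.linear s1 t1 f" and f': "Vector_Spaces.linear t1 s1 f'"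
    and g: "Vector_Spaces.linear s2 t2 g" and g': "Vector_Spaces.linear t2 s2 g'"
    and ff': "\<And>x. x \<in> V \<Longrightarrow> f' (f x) = x" and gg': "\<And>y. y \<in> W \<Longrightarrow> g' (g y) = y"
    and X: "X \<in> tensor_space s1 V s2 W"
  shows "tensor_map t1 t2 s1 s2 f' g' (tensor_map s1 s2 t1 t2 f g X) = X"
proof -
  have "\<forall>X\<in>tensor_space s1 V s2 W. tensor_map t1 t2 s1 s2 f' g' (tensor_map s1 s2 t1 t2 f g X) = X"
    by (rule tensor_space_ext) ((intro lin_intros f f' g g')+, simp add: tens_simps f f' g g' ff' gg')
  then show ?thesis using X by blast
qed


section \<open>The quotient coalgebra and its coactions\<close>

context coalgebra_epimorphism
begin

lemmas vector_spaces = A.vector_space_axioms C.vector_space_axioms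

abbreviation left_translation :: "'a \<Rightarrow> ('c, 'a, 'k) tensor" where
  "left_translation \<equiv> tensor_map sA sA sC sA \<pi> id \<circ> \<Delta>A"

abbreviation right_translation :: "'a \<Rightarrow> ('a, 'c, 'k) tensor" where
  "right_translation \<equiv> tensor_map sA sA sA sC id \<pi> \<circ> \<Delta>A"

lemma linear_left_translation: "Vector_Spaces.linear sA fscale left_translation"
  unfolding comp_def
  by (intro lin_intros linear_proj A.linear_comult vector_spaces)

lemma linear_right_translation: "Vector_Spaces.linear sA fscale right_translation"
  unfolding comp_def
  by (intro lin_intros linear_proj A.linear_comult vector_spaces)

lemmas basic_linear = linear_proj A.linear_comult A.linear_counit
  linear_left_translation linear_right_translation

lemmas linear_rules = lin_intros vector_spaces basic_linear basic_linear[THEN linear_comp] linear_tensor_map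

lemmas pure_tensor_simps = tens_simps linear_tensor_map linear_id linear_ident
  vector_space_fscale vector_spaces basic_linear

lemma comult_comult_left_in:
  "tensor_map sA sA fscale sA \<Delta>A id (\<Delta>A a)
     \<in> tensor_space fscale (tensor_space sA UNIV sA UNIV) sA UNIV"
  by (rule tensor_map_maps_tensor_space[OF _ _ A.comult_in[of a]])
    (auto intro!: A.comult_in lin_intros vector_spaces basic_linear)

lemma right_translation_in: "right_translation a \<in> tensor_space sA UNIV sC UNIV"
  unfolding comp_def
  by (rule tensor_map_maps_tensor_space[OF _ _ A.comult_in])
    (auto intro!: lin_intros vector_spaces basic_linear)

text \<open>
  \<open>L = (\<pi> \<otimes> id) \<circ> \<Delta>\<close> is a morphism of right \<open>A\<close>-comodules: the map \<open>\<pi>\<close> acts on the first factor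
  and commutes with \<open>id \<otimes> \<Delta>\<close>, so the claim is the coassociativity of \<open>\<Delta>\<close> with \<open>\<pi>\<close> applied to
  the first of its three factors.
\<close>

lemma left_translation_comult:
  "tensor_assoc_inv sC sA sA (tensor_map sC sA sC fscale id \<Delta>A (left_translation a)) =
   tensor_map sA sA fscale sA left_translation id (\<Delta>A a)"
proof -
  have "\<forall>X\<in>tensor_space sA UNIV sA UNIV. tensor_map sC sA sC fscale id \<Delta>A (tensor_map sA sA sC sA \<pi> id X) =
      tensor_map sA fscale sC fscale \<pi> id (tensor_map sA sA sA fscale id \<Delta>A X)"
    by (rule tensor_space_ext) ((intro linear_rules)+, simp add: pure_tensor_simps)
  then have "tensor_map sC sA sC fscale id \<Delta>A (left_translation a) =
      tensor_map sA fscale sC fscale \<pi> id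
        (tensor_assoc sA sA sA (tensor_map sA sA fscale sA \<Delta>A id (\<Delta>A a)))"
    by (simp add: A.comult_in A.coassoc)
  moreover have "\<forall>X\<in>tensor_space fscale (tensor_space sA UNIV sA UNIV) sA UNIV.
      tensor_assoc_inv sC sA sA (tensor_map sA fscale sC fscale \<pi> id (tensor_assoc sA sA sA X)) =
      tensor_map fscale sA fscale sA (tensor_map sA sA sC sA \<pi> id) id X"
    by (rule tensor_space_left_nested_ext) ((intro linear_rules)+, simp add: pure_tensor_simps)
  moreover have "\<forall>X\<in>tensor_space sA UNIV sA UNIV.
      tensor_map fscale sA fscale sA (tensor_map sA sA sC sA \<pi> id) id (tensor_map sA sA fscale sA \<Delta>A id X) =
      tensor_map sA sA fscale sA left_translation id X"
    \<comment> \<open>The translation must stay folded until its linearity has been used.\<close>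
    by (rule tensor_space_ext) ((intro linear_rules)+, simp add: pure_tensor_simps del: o_apply, simp)
  ultimately show ?thesis
    by (simp add: comult_comult_left_in A.comult_in)
qed

text \<open>
  On the other side, \<open>R = (id \<otimes> \<pi>) \<circ> \<Delta>\<close> is a morphism of left \<open>A\<close>-comodules.
\<close>

lemma right_translation_comult:
  "tensor_assoc sA sA sC (tensor_map sA sC fscale sC \<Delta>A id (right_translation a)) =
   tensor_map sA sA sA fscale id right_translation (\<Delta>A a)"
proof -
  have "\<forall>X\<in>tensor_space sA UNIV sA UNIV. tensor_map sA sC fscale sC \<Delta>A id (tensor_map sA sA sA sC id \<pi> X) =
      tensor_map fscale sA fscale sC id \<pi> (tensor_map sA sA fscale sA \<Delta>A id X)"
    by (rule tensor_space_ext) ((intro linear_rules)+, simp add: pure_tensor_simps)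
  moreover have "\<forall>X\<in>tensor_space fscale (tensor_space sA UNIV sA UNIV) sA UNIV.
      tensor_assoc sA sA sC (tensor_map fscale sA fscale sC id \<pi> X) =
      tensor_map sA fscale sA fscale id (tensor_map sA sA sA sC id \<pi>) (tensor_assoc sA sA sA X)"
    by (rule tensor_space_left_nested_ext) ((intro linear_rules)+, simp add: pure_tensor_simps)
  moreover have "\<forall>X\<in>tensor_space sA UNIV sA UNIV.
      tensor_map sA fscale sA fscale id (tensor_map sA sA sA sC id \<pi>) (tensor_map sA sA sA fscale id \<Delta>A X) =
      tensor_map sA sA sA fscale id right_translation X"
    \<comment> \<open>The translation must stay folded until its linearity has been used.\<close>
    by (rule tensor_space_ext) ((intro linear_rules)+, simp add: pure_tensor_simps del: o_apply, simp)
  ultimately show ?thesis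
    by (simp add: comult_comult_left_in A.comult_in A.coassoc)
qed

end


section \<open>Induction of right corepresentations\<close>

locale right_induction = coalgebra_epimorphism sA \<Delta>A \<epsilon>A sC \<Delta>C \<epsilon>C \<pi>
  for sA :: "'k::field \<Rightarrow> 'a::ab_group_add \<Rightarrow> 'a" and \<Delta>A \<epsilon>A
    and sC :: "'k \<Rightarrow> 'c::ab_group_add \<Rightarrow> 'c" and \<Delta>C \<epsilon>C \<pi> +
  fixes \<rho> :: "('k, 'v::ab_group_add, ('v, 'c, 'k) tensor) corep"
  assumes corep: "right_corepresentation sC \<Delta>C \<epsilon>C \<rho>"
begin

abbreviation "sV \<equiv> scalar \<rho>"
abbreviation "V \<equiv> carrier \<rho>"
abbreviation "ind \<equiv> ind_right sA \<Delta>A sC \<pi> \<rho>"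

text \<open>
  The two sides of the equation that defines the induced corepresentation, and its coaction.
\<close>

abbreviation "by_translation \<equiv> tensor_map sV sA sV fscale id left_translation"
abbreviation "by_coaction \<equiv> \<lambda>F. tensor_assoc sV sC sA (tensor_map sV sA fscale sA (coaction \<rho>) id F)"
abbreviation "ind_coaction \<equiv> \<lambda>F. tensor_assoc_inv sV sA sA (tensor_map sV sA sV fscale id \<Delta>A F)"

lemma carrier_ind: "carrier ind = {F \<in> tensor_space sV V sA UNIV. by_translation F = by_coaction F}"
  by (simp add: ind_right_def Let_def)

lemma scalar_ind: "scalar ind = fscale"
  by (simp add: ind_right_def Let_def)

lemma coaction_ind: "coaction ind = ind_coaction"
  by (simp add: ind_right_def Let_def comp_def)

lemma corep_linear:
  "vector_space sV" "Vector_Spaces.linear sV fscale (coaction \<rho>)"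
  using corep by (auto simp: right_corepresentation_def)

lemma coaction_in: "v \<in> V \<Longrightarrow> coaction \<rho> v \<in> tensor_space sV V sC UNIV"
  using corep by (auto simp: right_corepresentation_def)

lemmas ind_lins = linear_rules corep_linear corep_linear(2)[THEN linear_comp]
lemmas ind_simps = pure_tensor_simps corep_linear

lemma linear_by_translation: "Vector_Spaces.linear fscale fscale by_translation"
  by (intro ind_lins)

lemma linear_by_coaction: "Vector_Spaces.linear fscale fscale by_coaction"
  by (intro ind_lins)

lemma linear_ind_coaction: "Vector_Spaces.linear fscale fscale ind_coaction"
  by (intro ind_lins)

lemmas map_linear = linear_by_translation linear_by_coaction linear_ind_coaction
lemmas map_lins = ind_lins map_linear map_linear[THEN linear_comp]
lemmas map_simps = ind_simps map_linear

text \<open>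
  The map \<open>id \<otimes> id \<otimes> \<Delta>\<close> on \<open>V \<otimes> (C \<otimes> A)\<close>, bracketed so as to end in \<open>(V \<otimes> (C \<otimes> A)) \<otimes> A\<close>, which
  is where the two sides of the defining equation take values after tensoring with \<open>A\<close>.
\<close>

abbreviation "comult_last \<equiv> \<lambda>G. tensor_assoc_inv sV fscale sA
  (tensor_map sV fscale sV fscale id
    (\<lambda>t. tensor_assoc_inv sC sA sA (tensor_map sC sA sC fscale id \<Delta>A t)) G)"

lemma linear_comult_on_group_factor: "Vector_Spaces.linear fscale fscale
    (\<lambda>t. tensor_assoc_inv sC sA sA (tensor_map sC sA sC fscale id \<Delta>A t))"
  by (intro ind_lins)

lemma linear_comult_last: "Vector_Spaces.linear fscale fscale comult_last"
  by (intro ind_lins)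

text \<open>
  Comultiplying the last factor before or after translating gives the same result. On
  \<open>v \<otimes> a\<close> both orders of operation are linear functions of the iterated comultiplication, and
  they match because translation is a morphism of comodules.
\<close>

lemma by_translation_ind_coaction:
  "\<forall>F\<in>tensor_space sV V sA UNIV.
     tensor_map fscale sA fscale sA by_translation id (ind_coaction F) = comult_last (by_translation F)"
proof (rule tensor_space_ext)
  fix v a
  have "\<forall>X\<in>tensor_space sA UNIV sA UNIV.
      tensor_map fscale sA fscale sA by_translation id (tensor_assoc_inv sV sA sA (tens sV fscale v X)) =
      tensor_assoc_inv sV fscale sA (tens sV fscale v (tensor_map sA sA fscale sA left_translation id X))"
    by (rule tensor_space_ext) ((intro map_lins)+, simp add: map_simps del: o_apply)
  then show "tensor_map fscale sA fscale sA by_translation id (ind_coaction (tens sV sA v a)) =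
      comult_last (by_translation (tens sV sA v a))"
    by (simp add: map_simps linear_comult_on_group_factor A.comult_in left_translation_comult del: o_apply)
qed (intro map_lins linear_comult_on_group_factor linear_comp[OF linear_comult_last])+

text \<open>
  The coaction of \<open>C\<close> and the comultiplication act on different factors of \<open>V \<otimes> A\<close>, so they
  commute; only the brackets have to be moved. The values \<open>\<rho> v\<close> and \<open>\<Delta> a\<close> are not pure tensors,
  but both sides are linear in each of them, so that each may be replaced by pure tensors.
\<close>

lemma by_coaction_ind_coaction:
  "\<forall>F\<in>tensor_space sV V sA UNIV.
     tensor_map fscale sA fscale sA by_coaction id (ind_coaction F) = comult_last (by_coaction F)"
proof (rule tensor_space_ext)
  fix v a assume v: "v \<in> V"
  have 1: "\<forall>X\<in>tensor_space sA UNIV sA UNIV.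
      tensor_map fscale sA fscale sA by_coaction id (tensor_assoc_inv sV sA sA (tens sV fscale v X)) =
      tensor_map fscale sA fscale sA (tensor_assoc sV sC sA) id
        (tensor_assoc_inv fscale sA sA (tens fscale fscale (coaction \<rho> v) X))"
    by (rule tensor_space_ext)
      ((intro map_lins linear_tensor_assoc)+, simp add: map_simps linear_tensor_assoc)
  have "\<forall>r\<in>tensor_space sV V sC UNIV.
      tensor_map fscale sA fscale sA (tensor_assoc sV sC sA) id
        (tensor_assoc_inv fscale sA sA (tens fscale fscale r (\<Delta>A a))) =
      comult_last (tensor_assoc sV sC sA (tens fscale sA r a))"
  proof (rule tensor_space_ext)
    fix u c
    have "\<forall>X\<in>tensor_space sA UNIV sA UNIV.
        tensor_map fscale sA fscale sA (tensor_assoc sV sC sA) id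
          (tensor_assoc_inv fscale sA sA (tens fscale fscale (tens sV sC u c) X)) =
        tensor_assoc_inv sV fscale sA (tens sV fscale u (tensor_assoc_inv sC sA sA (tens sC fscale c X)))"
      by (rule tensor_space_ext)
        ((intro map_lins linear_tensor_assoc)+, simp add: map_simps linear_tensor_assoc)
    then show "tensor_map fscale sA fscale sA (tensor_assoc sV sC sA) id
          (tensor_assoc_inv fscale sA sA (tens fscale fscale (tens sV sC u c) (\<Delta>A a))) =
        comult_last (tensor_assoc sV sC sA (tens fscale sA (tens sV sC u c) a))"
      by (simp add: map_simps linear_comult_on_group_factor A.comult_in)
  qed (intro map_lins linear_comult_on_group_factor linear_tensor_assoc)+
  then show "tensor_map fscale sA fscale sA by_coaction id (ind_coaction (tens sV sA v a)) =
      comult_last (by_coaction (tens sV sA v a))"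
    using 1 v by (simp add: map_simps A.comult_in coaction_in)
qed (intro map_lins linear_comult_on_group_factor linear_comp[OF linear_comult_last])+

lemma ind_coaction_in_tensor_space:
  assumes F: "F \<in> tensor_space sV V sA UNIV"
  shows "ind_coaction F \<in> tensor_space fscale (tensor_space sV V sA UNIV) sA UNIV"
proof (rule linear_maps_tensor_space[OF linear_ind_coaction subspace_tensor_space F])
  fix v a assume v: "v \<in> V"
  have "tensor_assoc_inv sV sA sA (tens sV fscale v (\<Delta>A a))
      \<in> tensor_space fscale (tensor_space sV V sA UNIV) sA UNIV"
    by (rule linear_maps_tensor_space[OF _ subspace_tensor_space A.comult_in])
      ((intro map_lins)+, auto simp: map_simps intro!: tens_in_tensor_space v)
  then show "ind_coaction (tens sV sA v a) \<in> tensor_space fscale (tensor_space sV V sA UNIV) sA UNIV"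
    by (simp add: map_simps)
qed

text \<open>
  The key point of the construction: the two defining maps, tensored with \<open>id\<close>, agree on
  \<open>(id \<otimes> \<Delta>) F\<close>, because they commute with the comultiplication and agree on \<open>F\<close>. Flatness then
  puts \<open>(id \<otimes> \<Delta>) F\<close> into the tensor product of the equalizer with \<open>A\<close>.
\<close>

lemma ind_coaction_in:
  assumes "F \<in> carrier ind"
  shows "ind_coaction F \<in> tensor_space fscale (carrier ind) sA UNIV"
  unfolding carrier_ind
proof (rule tensor_equalizer_left_factor[OF linear_by_translation linear_by_coaction subspace_tensor_space vector_spaces(1)])
  have F: "F \<in> tensor_space sV V sA UNIV" and eq: "by_translation F = by_coaction F"
    using assms by (auto simp: carrier_ind)
  show "ind_coaction F \<in> tensor_space fscale (tensor_space sV V sA UNIV) sA UNIV"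
    using F by (rule ind_coaction_in_tensor_space)
  show "tensor_map fscale sA fscale sA by_translation id (ind_coaction F) =
      tensor_map fscale sA fscale sA by_coaction id (ind_coaction F)"
    using by_translation_ind_coaction by_coaction_ind_coaction F eq by simp
qed

text \<open>
  On \<open>v \<otimes> a\<close> both sides are obtained from the two sides of the coassociativity law at \<open>a\<close> by
  prepending the vector \<open>v\<close>.
\<close>

lemma ind_coaction_coassoc:
  "\<forall>F\<in>tensor_space sV V sA UNIV.
     tensor_assoc fscale sA sA (tensor_map fscale sA fscale sA ind_coaction id (ind_coaction F)) =
     tensor_map fscale sA fscale fscale id \<Delta>A (ind_coaction F)"
proof (rule tensor_space_ext)
  fix v a
  have 1: "\<forall>X\<in>tensor_space sA UNIV sA UNIV.
      tensor_assoc fscale sA sA (tensor_map fscale sA fscale sA ind_coaction id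
        (tensor_assoc_inv sV sA sA (tens sV fscale v X))) =
      tensor_assoc_inv sV sA fscale (tens sV fscale v
        (tensor_assoc sA sA sA (tensor_map sA sA fscale sA \<Delta>A id X)))"
  proof (rule tensor_space_ext)
    fix b c
    have "\<forall>Y\<in>tensor_space sA UNIV sA UNIV.
        tensor_assoc fscale sA sA (tens fscale sA (tensor_assoc_inv sV sA sA (tens sV fscale v Y)) c) =
        tensor_assoc_inv sV sA fscale (tens sV fscale v (tensor_assoc sA sA sA (tens fscale sA Y c)))"
      by (rule tensor_space_ext) ((intro map_lins)+, simp add: map_simps)
    then show "tensor_assoc fscale sA sA (tensor_map fscale sA fscale sA ind_coaction id
          (tensor_assoc_inv sV sA sA (tens sV fscale v (tens sA sA b c)))) =
        tensor_assoc_inv sV sA fscale (tens sV fscale v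
          (tensor_assoc sA sA sA (tensor_map sA sA fscale sA \<Delta>A id (tens sA sA b c))))"
      by (simp add: map_simps A.comult_in)
  qed (intro map_lins)+
  have 2: "\<forall>X\<in>tensor_space sA UNIV sA UNIV.
      tensor_map fscale sA fscale fscale id \<Delta>A (tensor_assoc_inv sV sA sA (tens sV fscale v X)) =
      tensor_assoc_inv sV sA fscale (tens sV fscale v (tensor_map sA sA sA fscale id \<Delta>A X))"
    by (rule tensor_space_ext) ((intro map_lins)+, simp add: map_simps)
  show "tensor_assoc fscale sA sA
        (tensor_map fscale sA fscale sA ind_coaction id (ind_coaction (tens sV sA v a))) =
      tensor_map fscale sA fscale fscale id \<Delta>A (ind_coaction (tens sV sA v a))"
    using 1 2 by (simp add: map_simps A.comult_in A.coassoc)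
qed (intro map_lins)+

lemma ind_coaction_counit:
  "\<forall>F\<in>tensor_space sV V sA UNIV.
     tensor_map fscale sA fscale (*) id \<epsilon>A (ind_coaction F) = tens fscale (*) F 1"
proof (rule tensor_space_ext)
  fix v a
  have "\<forall>X\<in>tensor_space sA UNIV sA UNIV.
      tensor_map fscale sA fscale (*) id \<epsilon>A (tensor_assoc_inv sV sA sA (tens sV fscale v X)) =
      tensor_assoc_inv sV sA (*) (tens sV fscale v (tensor_map sA sA sA (*) id \<epsilon>A X))"
    by (rule tensor_space_ext) ((intro map_lins)+, simp add: map_simps vector_space_times)
  then show "tensor_map fscale sA fscale (*) id \<epsilon>A (ind_coaction (tens sV sA v a)) =
      tens fscale (*) (tens sV sA v a) 1"
    by (simp add: map_simps A.comult_in A.counit_right vector_space_times)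
qed (intro map_lins)+

theorem right_corepresentation_ind: "right_corepresentation sA \<Delta>A \<epsilon>A ind"
  unfolding right_corepresentation_def scalar_ind coaction_ind
proof (intro conjI ballI)
  show "fs.subspace (carrier ind)"
    unfolding carrier_ind
    by (rule subspace_equalizer[OF linear_by_translation linear_by_coaction subspace_tensor_space])
  fix F assume F: "F \<in> carrier ind"
  then have F': "F \<in> tensor_space sV V sA UNIV" by (simp add: carrier_ind)
  show "ind_coaction F \<in> tensor_space fscale (carrier ind) sA UNIV"
    using F by (rule ind_coaction_in)
  show "tensor_assoc fscale sA sA (tensor_map fscale sA fscale sA ind_coaction id (ind_coaction F)) =
      tensor_map fscale sA fscale fscale id \<Delta>A (ind_coaction F)"
    using ind_coaction_coassoc F' by blast
  show "tensor_map fscale sA fscale (*) id \<epsilon>A (ind_coaction F) = tens fscale (*) F 1"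
    using ind_coaction_counit F' by blast
qed (rule vector_space_fscale linear_ind_coaction)+

end

context coalgebra_epimorphism
begin

text \<open>
  Both defining maps are natural in the corepresentation: translation since it does not involve
  \<open>V\<close>, the coaction since \<open>T\<close> intertwines. Hence \<open>T \<otimes> id\<close> preserves the defining equation.
\<close>

lemma right_intertwiner_maps_ind:
  assumes \<rho>: "right_corepresentation sC \<Delta>C \<epsilon>C \<rho>" and \<rho>': "right_corepresentation sC \<Delta>C \<epsilon>C \<rho>'"
    and T: "Vector_Spaces.linear (scalar \<rho>) (scalar \<rho>') T"
    and into: "\<And>v. v \<in> carrier \<rho> \<Longrightarrow> T v \<in> carrier \<rho>'"
    and intertwines: "\<And>v. v \<in> carrier \<rho> \<Longrightarrow>
      coaction \<rho>' (T v) = tensor_map (scalar \<rho>) sC (scalar \<rho>') sC T id (coaction \<rho> v)"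
    and F: "F \<in> carrier (ind_right sA \<Delta>A sC \<pi> \<rho>)"
  shows "tensor_map (scalar \<rho>) sA (scalar \<rho>') sA T id F \<in> carrier (ind_right sA \<Delta>A sC \<pi> \<rho>')"
proof -
  interpret r: right_induction sA \<Delta>A \<epsilon>A sC \<Delta>C \<epsilon>C \<pi> \<rho> by unfold_locales (rule \<rho>)
  interpret r': right_induction sA \<Delta>A \<epsilon>A sC \<Delta>C \<epsilon>C \<pi> \<rho>' by unfold_locales (rule \<rho>')
  let ?T = "tensor_map r.sV sA r'.sV sA T id"
  let ?T' = "tensor_map r.sV fscale r'.sV fscale T id"
  note T_lins = r.map_lins r'.map_lins T T[THEN linear_comp]
  note T_simps = r.map_simps r'.map_simps T
  have F': "F \<in> tensor_space r.sV r.V sA UNIV" and eq: "r.by_translation F = r.by_coaction F"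
    using F by (auto simp: r.carrier_ind)
  have "\<forall>F\<in>tensor_space r.sV r.V sA UNIV. r'.by_translation (?T F) = ?T' (r.by_translation F)"
    by (rule tensor_space_ext) ((intro T_lins)+, simp add: T_simps del: o_apply)
  moreover have "\<forall>F\<in>tensor_space r.sV r.V sA UNIV. r'.by_coaction (?T F) = ?T' (r.by_coaction F)"
  proof (rule tensor_space_ext)
    fix v a assume v: "v \<in> r.V"
    have "\<forall>X\<in>tensor_space r.sV r.V sC UNIV.
        tensor_assoc r'.sV sC sA (tens fscale sA (tensor_map r.sV sC r'.sV sC T id X) a) =
        ?T' (tensor_assoc r.sV sC sA (tens fscale sA X a))"
      by (rule tensor_space_ext) ((intro T_lins)+, simp add: T_simps)
    then show "r'.by_coaction (?T (tens r.sV sA v a)) = ?T' (r.by_coaction (tens r.sV sA v a))"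
      using v by (simp add: T_simps intertwines r.coaction_in)
  qed (intro T_lins)+
  ultimately have "r'.by_translation (?T F) = r'.by_coaction (?T F)" using F' eq by simp
  moreover have "?T F \<in> tensor_space r'.sV r'.V sA UNIV"
    by (rule tensor_map_maps_tensor_space[OF T _ F']) (auto intro: into T_lins)
  ultimately show ?thesis by (simp add: r'.carrier_ind)
qed

lemma right_intertwiner_ind_coaction:
  assumes \<rho>: "right_corepresentation sC \<Delta>C \<epsilon>C \<rho>" and \<rho>': "right_corepresentation sC \<Delta>C \<epsilon>C \<rho>'"
    and T: "Vector_Spaces.linear (scalar \<rho>) (scalar \<rho>') T"
    and F: "F \<in> carrier (ind_right sA \<Delta>A sC \<pi> \<rho>)"
  shows "coaction (ind_right sA \<Delta>A sC \<pi> \<rho>') (tensor_map (scalar \<rho>) sA (scalar \<rho>') sA T id F) =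
    tensor_map fscale sA fscale sA (tensor_map (scalar \<rho>) sA (scalar \<rho>') sA T id) id
      (coaction (ind_right sA \<Delta>A sC \<pi> \<rho>) F)"
proof -
  interpret r: right_induction sA \<Delta>A \<epsilon>A sC \<Delta>C \<epsilon>C \<pi> \<rho> by unfold_locales (rule \<rho>)
  interpret r': right_induction sA \<Delta>A \<epsilon>A sC \<Delta>C \<epsilon>C \<pi> \<rho>' by unfold_locales (rule \<rho>')
  let ?T = "tensor_map r.sV sA r'.sV sA T id"
  note T_lins = r.map_lins r'.map_lins T T[THEN linear_comp]
  note T_simps = r.map_simps r'.map_simps T
  have "\<forall>F\<in>tensor_space r.sV r.V sA UNIV.
      r'.ind_coaction (?T F) = tensor_map fscale sA fscale sA ?T id (r.ind_coaction F)"
  proof (rule tensor_space_ext)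
    fix v a
    have "\<forall>X\<in>tensor_space sA UNIV sA UNIV.
        tensor_assoc_inv r'.sV sA sA (tens r'.sV fscale (T v) X) =
        tensor_map fscale sA fscale sA ?T id (tensor_assoc_inv r.sV sA sA (tens r.sV fscale v X))"
      by (rule tensor_space_ext) ((intro T_lins)+, simp add: T_simps)
    then show "r'.ind_coaction (?T (tens r.sV sA v a)) =
        tensor_map fscale sA fscale sA ?T id (r.ind_coaction (tens r.sV sA v a))"
      by (simp add: T_simps A.comult_in)
  qed (intro T_lins)+
  then show ?thesis using F by (simp add: r.carrier_ind r.coaction_ind r'.coaction_ind)
qed

theorem equivalent_right_coreps_ind:
  assumes "equivalent_right_coreps sC \<Delta>C \<epsilon>C \<rho> \<rho>'"
  shows "equivalent_right_coreps sA \<Delta>A \<epsilon>A (ind_right sA \<Delta>A sC \<pi> \<rho>) (ind_right sA \<Delta>A sC \<pi> \<rho>')"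
proof -
  obtain T where \<rho>: "right_corepresentation sC \<Delta>C \<epsilon>C \<rho>" and \<rho>': "right_corepresentation sC \<Delta>C \<epsilon>C \<rho>'"
    and T: "Vector_Spaces.linear (scalar \<rho>) (scalar \<rho>') T"
    and bij: "bij_betw T (carrier \<rho>) (carrier \<rho>')"
    and T_int: "\<And>v. v \<in> carrier \<rho> \<Longrightarrow>
      coaction \<rho>' (T v) = tensor_map (scalar \<rho>) sC (scalar \<rho>') sC T id (coaction \<rho> v)"
    using assms unfolding equivalent_right_coreps_def by blast
  interpret r: right_induction sA \<Delta>A \<epsilon>A sC \<Delta>C \<epsilon>C \<pi> \<rho> by unfold_locales (rule \<rho>)
  interpret r': right_induction sA \<Delta>A \<epsilon>A sC \<Delta>C \<epsilon>C \<pi> \<rho>' by unfold_locales (rule \<rho>')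
  have "module.subspace r.sV r.V" using \<rho> by (simp add: right_corepresentation_def)
  then obtain g where g: "Vector_Spaces.linear r'.sV r.sV g"
    and gT: "\<And>v. v \<in> r.V \<Longrightarrow> g (T v) = v" and g_in: "\<And>w. w \<in> r'.V \<Longrightarrow> g w \<in> r.V"
    and Tg: "\<And>w. w \<in> r'.V \<Longrightarrow> T (g w) = w"
    using linear_bij_betw_inverse[OF T _ bij] by blast
  have T_in: "T v \<in> r'.V" if "v \<in> r.V" for v using bij that by (auto simp: bij_betw_def)
  \<comment> \<open>The inverse intertwines as well: apply it to the equation for \<open>T\<close> at \<open>g w\<close>.\<close>
  have g_int: "coaction \<rho> (g w) = tensor_map r'.sV sC r.sV sC g id (coaction \<rho>' w)" if w: "w \<in> r'.V" for w
  proof -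
    have "coaction \<rho>' w = tensor_map r.sV sC r'.sV sC T id (coaction \<rho> (g w))"
      using T_int[OF g_in[OF w]] Tg[OF w] by simp
    moreover have "tensor_map r'.sV sC r.sV sC g id (tensor_map r.sV sC r'.sV sC T id (coaction \<rho> (g w))) =
        coaction \<rho> (g w)"
      by (rule tensor_map_inverse[OF T g _ _ gT _ r.coaction_in[OF g_in[OF w]]])
        (simp_all add: linear_id vector_spaces)
    ultimately show ?thesis by simp
  qed
  let ?T = "tensor_map r.sV sA r'.sV sA T id" and ?g = "tensor_map r'.sV sA r.sV sA g id"
  have "bij_betw ?T (carrier r.ind) (carrier r'.ind)"
  proof (rule bij_betw_byWitness[where f' = ?g])
    show "\<forall>F\<in>carrier r.ind. ?g (?T F) = F"
    proof
      fix F assume "F \<in> carrier r.ind"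
      then have F: "F \<in> tensor_space r.sV r.V sA UNIV" by (simp add: r.carrier_ind)
      show "?g (?T F) = F"
        by (rule tensor_map_inverse[OF T g _ _ gT _ F]) (simp_all add: linear_id vector_spaces)
    qed
    show "\<forall>F\<in>carrier r'.ind. ?T (?g F) = F"
    proof
      fix F assume "F \<in> carrier r'.ind"
      then have F: "F \<in> tensor_space r'.sV r'.V sA UNIV" by (simp add: r'.carrier_ind)
      show "?T (?g F) = F"
        by (rule tensor_map_inverse[OF g T _ _ Tg _ F]) (simp_all add: linear_id vector_spaces)
    qed
    show "?T ` carrier r.ind \<subseteq> carrier r'.ind"
      using right_intertwiner_maps_ind[OF \<rho> \<rho>' T T_in T_int] by blast
    show "?g ` carrier r'.ind \<subseteq> carrier r.ind"
      using right_intertwiner_maps_ind[OF \<rho>' \<rho> g g_in g_int] by blast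
  qed
  moreover have "Vector_Spaces.linear fscale fscale ?T"
    by (intro linear_tensor_map T linear_id vector_spaces)
  ultimately show ?thesis
    unfolding equivalent_right_coreps_def r.scalar_ind r'.scalar_ind
    using r.right_corepresentation_ind r'.right_corepresentation_ind
      right_intertwiner_ind_coaction[OF \<rho> \<rho>' T] by blast
qed

end


section \<open>Induction of left corepresentations\<close>

locale left_induction = coalgebra_epimorphism sA \<Delta>A \<epsilon>A sC \<Delta>C \<epsilon>C \<pi>
  for sA :: "'k::field \<Rightarrow> 'a::ab_group_add \<Rightarrow> 'a" and \<Delta>A \<epsilon>A
    and sC :: "'k \<Rightarrow> 'c::ab_group_add \<Rightarrow> 'c" and \<Delta>C \<epsilon>C \<pi> +
  fixes \<rho> :: "('k, 'v::ab_group_add, ('c, 'v, 'k) tensor) corep"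
  assumes corep: "left_corepresentation sC \<Delta>C \<epsilon>C \<rho>"
begin

abbreviation "sV \<equiv> scalar \<rho>"
abbreviation "V \<equiv> carrier \<rho>"
abbreviation "ind \<equiv> ind_left sA \<Delta>A sC \<pi> \<rho>"

text \<open>
  The mirror images of the maps used for right corepresentations. The canonical bracketing is now
  \<open>A \<otimes> (C \<otimes> V)\<close>, so reassociation accompanies translation instead of the coaction of \<open>V\<close>.
\<close>

abbreviation "by_translation \<equiv> \<lambda>F. tensor_assoc sA sC sV (tensor_map sA sV fscale sV right_translation id F)"
abbreviation "by_coaction \<equiv> tensor_map sA sV sA fscale id (coaction \<rho>)"
abbreviation "ind_coaction \<equiv> \<lambda>F. tensor_assoc sA sA sV (tensor_map sA sV fscale sV \<Delta>A id F)"

lemma carrier_ind: "carrier ind = {F \<in> tensor_space sA UNIV sV V. by_translation F = by_coaction F}"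
  by (simp add: ind_left_def Let_def)

lemma scalar_ind: "scalar ind = fscale"
  by (simp add: ind_left_def Let_def)

lemma coaction_ind: "coaction ind = ind_coaction"
  by (simp add: ind_left_def Let_def comp_def)

lemma corep_linear:
  "vector_space sV" "Vector_Spaces.linear sV fscale (coaction \<rho>)"
  using corep by (auto simp: left_corepresentation_def)

lemma coaction_in: "v \<in> V \<Longrightarrow> coaction \<rho> v \<in> tensor_space sC UNIV sV V"
  using corep by (auto simp: left_corepresentation_def)

lemmas ind_lins = linear_rules corep_linear corep_linear(2)[THEN linear_comp]
lemmas ind_simps = pure_tensor_simps corep_linear

lemma linear_by_translation: "Vector_Spaces.linear fscale fscale by_translation"
  by (intro ind_lins)

lemma linear_by_coaction: "Vector_Spaces.linear fscale fscale by_coaction"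
  by (intro ind_lins)

lemma linear_ind_coaction: "Vector_Spaces.linear fscale fscale ind_coaction"
  by (intro ind_lins)

lemmas map_linear = linear_by_translation linear_by_coaction linear_ind_coaction
lemmas map_lins = ind_lins map_linear map_linear[THEN linear_comp]
lemmas map_simps = ind_simps map_linear

text \<open>
  The map \<open>\<Delta> \<otimes> id \<otimes> id\<close> on \<open>A \<otimes> (C \<otimes> V)\<close>, with values in \<open>A \<otimes> (A \<otimes> (C \<otimes> V))\<close>.
\<close>

abbreviation "comult_first \<equiv> \<lambda>G. tensor_assoc sA sA fscale (tensor_map sA fscale fscale fscale \<Delta>A id G)"

lemma linear_comult_first: "Vector_Spaces.linear fscale fscale comult_first"
  by (intro ind_lins)

text \<open>
  Appending the vector \<open>v\<close> on the right and moving the brackets. It carries identities in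
  \<open>A \<otimes> (A \<otimes> C)\<close> or \<open>A \<otimes> (A \<otimes> A)\<close> to the spaces that involve \<open>V\<close>.
\<close>

lemma linear_append: "vector_space s \<Longrightarrow>
    Vector_Spaces.linear fscale fscale (\<lambda>t. tensor_assoc sA s sV (tens fscale sV t v))"
  by (intro ind_lins)

text \<open>
  On \<open>a \<otimes> v\<close> this is the comodule property of the right translation with \<open>v\<close> appended.
\<close>

lemma by_translation_ind_coaction:
  "\<forall>F\<in>tensor_space sA UNIV sV V.
     tensor_map sA fscale sA fscale id by_translation (ind_coaction F) = comult_first (by_translation F)"
proof (rule tensor_space_ext)
  fix a v
  let ?append = "tensor_map sA fscale sA fscale id (\<lambda>t. tensor_assoc sA sC sV (tens fscale sV t v))"
  have 1: "\<forall>X\<in>tensor_space sA UNIV sA UNIV.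
      tensor_map sA fscale sA fscale id by_translation (tensor_assoc sA sA sV (tens fscale sV X v)) =
      ?append (tensor_map sA sA sA fscale id right_translation X)"
    by (rule tensor_space_ext)
      ((intro map_lins linear_append)+, simp add: map_simps linear_append del: o_apply)
  have 2: "\<forall>X\<in>tensor_space sA UNIV sC UNIV.
      comult_first (tensor_assoc sA sC sV (tens fscale sV X v)) =
      ?append (tensor_assoc sA sA sC (tensor_map sA sC fscale sC \<Delta>A id X))"
  proof (rule tensor_space_ext)
    fix b c
    have "\<forall>Y\<in>tensor_space sA UNIV sA UNIV.
        tensor_assoc sA sA fscale (tens fscale fscale Y (tens sC sV c v)) =
        ?append (tensor_assoc sA sA sC (tens fscale sC Y c))"
      by (rule tensor_space_ext) ((intro map_lins linear_append)+, simp add: map_simps linear_append)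
    then show "comult_first (tensor_assoc sA sC sV (tens fscale sV (tens sA sC b c) v)) =
        ?append (tensor_assoc sA sA sC (tensor_map sA sC fscale sC \<Delta>A id (tens sA sC b c)))"
      by (simp add: map_simps A.comult_in)
  qed (intro map_lins linear_append linear_comp[OF linear_comult_first])+
  show "tensor_map sA fscale sA fscale id by_translation (ind_coaction (tens sA sV a v)) =
      comult_first (by_translation (tens sA sV a v))"
    using 1 2 right_translation_in[of a]
    by (simp add: map_simps A.comult_in right_translation_comult del: o_apply)
qed (intro map_lins linear_comp[OF linear_comult_first])+

lemma by_coaction_ind_coaction:
  "\<forall>F\<in>tensor_space sA UNIV sV V.
     tensor_map sA fscale sA fscale id by_coaction (ind_coaction F) = comult_first (by_coaction F)"
proof (rule tensor_space_ext)
  fix a v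
  have "\<forall>X\<in>tensor_space sA UNIV sA UNIV.
      tensor_map sA fscale sA fscale id by_coaction (tensor_assoc sA sA sV (tens fscale sV X v)) =
      tensor_assoc sA sA fscale (tens fscale fscale X (coaction \<rho> v))"
    by (rule tensor_space_ext) ((intro map_lins)+, simp add: map_simps)
  then show "tensor_map sA fscale sA fscale id by_coaction (ind_coaction (tens sA sV a v)) =
      comult_first (by_coaction (tens sA sV a v))"
    by (simp add: map_simps A.comult_in)
qed (intro map_lins linear_comp[OF linear_comult_first])+

lemma ind_coaction_in_tensor_space:
  assumes F: "F \<in> tensor_space sA UNIV sV V"
  shows "ind_coaction F \<in> tensor_space sA UNIV fscale (tensor_space sA UNIV sV V)"
proof (rule linear_maps_tensor_space[OF linear_ind_coaction subspace_tensor_space F])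
  fix a v assume v: "v \<in> V"
  have "tensor_assoc sA sA sV (tens fscale sV (\<Delta>A a) v)
      \<in> tensor_space sA UNIV fscale (tensor_space sA UNIV sV V)"
    by (rule linear_maps_tensor_space[OF _ subspace_tensor_space A.comult_in])
      ((intro map_lins)+, auto simp: map_simps intro!: tens_in_tensor_space v)
  then show "ind_coaction (tens sA sV a v) \<in> tensor_space sA UNIV fscale (tensor_space sA UNIV sV V)"
    by (simp add: map_simps)
qed

lemma ind_coaction_in:
  assumes "F \<in> carrier ind"
  shows "ind_coaction F \<in> tensor_space sA UNIV fscale (carrier ind)"
  unfolding carrier_ind
proof (rule tensor_equalizer_right_factor[OF linear_by_translation linear_by_coaction
      subspace_tensor_space vector_spaces(1)])
  have F: "F \<in> tensor_space sA UNIV sV V" and eq: "by_translation F = by_coaction F"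
    using assms by (auto simp: carrier_ind)
  show "ind_coaction F \<in> tensor_space sA UNIV fscale (tensor_space sA UNIV sV V)"
    using F by (rule ind_coaction_in_tensor_space)
  show "tensor_map sA fscale sA fscale id by_translation (ind_coaction F) =
      tensor_map sA fscale sA fscale id by_coaction (ind_coaction F)"
    using by_translation_ind_coaction by_coaction_ind_coaction F eq by simp
qed

text \<open>
  On \<open>a \<otimes> v\<close> both sides are obtained from the two sides of the coassociativity law at \<open>a\<close> by
  appending the vector \<open>v\<close>.
\<close>

lemma ind_coaction_coassoc:
  "\<forall>F\<in>tensor_space sA UNIV sV V.
     tensor_assoc sA sA fscale (tensor_map sA fscale fscale fscale \<Delta>A id (ind_coaction F)) =
     tensor_map sA fscale sA fscale id ind_coaction (ind_coaction F)"
proof (rule tensor_space_ext)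
  fix a v
  let ?append = "tensor_map sA fscale sA fscale id (\<lambda>t. tensor_assoc sA sA sV (tens fscale sV t v))"
  have 1: "\<forall>X\<in>tensor_space sA UNIV sA UNIV.
      tensor_assoc sA sA fscale (tensor_map sA fscale fscale fscale \<Delta>A id
        (tensor_assoc sA sA sV (tens fscale sV X v))) =
      ?append (tensor_assoc sA sA sA (tensor_map sA sA fscale sA \<Delta>A id X))"
  proof (rule tensor_space_ext)
    fix b c
    have "\<forall>Y\<in>tensor_space sA UNIV sA UNIV.
        tensor_assoc sA sA fscale (tens fscale fscale Y (tens sA sV c v)) =
        ?append (tensor_assoc sA sA sA (tens fscale sA Y c))"
      by (rule tensor_space_ext) ((intro map_lins linear_append)+, simp add: map_simps linear_append)
    then show "tensor_assoc sA sA fscale (tensor_map sA fscale fscale fscale \<Delta>A id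
          (tensor_assoc sA sA sV (tens fscale sV (tens sA sA b c) v))) =
        ?append (tensor_assoc sA sA sA (tensor_map sA sA fscale sA \<Delta>A id (tens sA sA b c)))"
      by (simp add: map_simps A.comult_in)
  qed (intro map_lins linear_append)+
  have 2: "\<forall>X\<in>tensor_space sA UNIV sA UNIV.
      tensor_map sA fscale sA fscale id ind_coaction (tensor_assoc sA sA sV (tens fscale sV X v)) =
      ?append (tensor_map sA sA sA fscale id \<Delta>A X)"
    by (rule tensor_space_ext) ((intro map_lins linear_append)+, simp add: map_simps linear_append)
  show "tensor_assoc sA sA fscale
        (tensor_map sA fscale fscale fscale \<Delta>A id (ind_coaction (tens sA sV a v))) =
      tensor_map sA fscale sA fscale id ind_coaction (ind_coaction (tens sA sV a v))"
    using 1 2 by (simp add: map_simps A.comult_in A.coassoc)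
qed (intro map_lins)+

lemma ind_coaction_counit:
  "\<forall>F\<in>tensor_space sA UNIV sV V.
     tensor_map sA fscale (*) fscale \<epsilon>A id (ind_coaction F) = tens (*) fscale 1 F"
proof (rule tensor_space_ext)
  fix a v
  have "\<forall>X\<in>tensor_space sA UNIV sA UNIV.
      tensor_map sA fscale (*) fscale \<epsilon>A id (tensor_assoc sA sA sV (tens fscale sV X v)) =
      tensor_assoc (*) sA sV (tens fscale sV (tensor_map sA sA (*) sA \<epsilon>A id X) v)"
    by (rule tensor_space_ext) ((intro map_lins)+, simp add: map_simps vector_space_times)
  then show "tensor_map sA fscale (*) fscale \<epsilon>A id (ind_coaction (tens sA sV a v)) =
      tens (*) fscale 1 (tens sA sV a v)"
    by (simp add: map_simps A.comult_in A.counit_left vector_space_times)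
qed (intro map_lins)+

theorem left_corepresentation_ind: "left_corepresentation sA \<Delta>A \<epsilon>A ind"
  unfolding left_corepresentation_def scalar_ind coaction_ind
proof (intro conjI ballI)
  show "fs.subspace (carrier ind)"
    unfolding carrier_ind
    by (rule subspace_equalizer[OF linear_by_translation linear_by_coaction subspace_tensor_space])
  fix F assume F: "F \<in> carrier ind"
  then have F': "F \<in> tensor_space sA UNIV sV V" by (simp add: carrier_ind)
  show "ind_coaction F \<in> tensor_space sA UNIV fscale (carrier ind)"
    using F by (rule ind_coaction_in)
  show "tensor_assoc sA sA fscale (tensor_map sA fscale fscale fscale \<Delta>A id (ind_coaction F)) =
      tensor_map sA fscale sA fscale id ind_coaction (ind_coaction F)"
    using ind_coaction_coassoc F' by blast
  show "tensor_map sA fscale (*) fscale \<epsilon>A id (ind_coaction F) = tens (*) fscale 1 F"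
    using ind_coaction_counit F' by blast
qed (rule vector_space_fscale linear_ind_coaction)+

end

context coalgebra_epimorphism
begin

text \<open>
  Both defining maps are natural in the corepresentation: translation since it does not involve
  \<open>V\<close>, the coaction since \<open>T\<close> intertwines. Hence \<open>id \<otimes> T\<close> preserves the defining equation.
\<close>

lemma left_intertwiner_maps_ind:
  assumes \<rho>: "left_corepresentation sC \<Delta>C \<epsilon>C \<rho>" and \<rho>': "left_corepresentation sC \<Delta>C \<epsilon>C \<rho>'"
    and T: "Vector_Spaces.linear (scalar \<rho>) (scalar \<rho>') T"
    and into: "\<And>v. v \<in> carrier \<rho> \<Longrightarrow> T v \<in> carrier \<rho>'"
    and intertwines: "\<And>v. v \<in> carrier \<rho> \<Longrightarrow>
      coaction \<rho>' (T v) = tensor_map sC (scalar \<rho>) sC (scalar \<rho>') id T (coaction \<rho> v)"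
    and F: "F \<in> carrier (ind_left sA \<Delta>A sC \<pi> \<rho>)"
  shows "tensor_map sA (scalar \<rho>) sA (scalar \<rho>') id T F \<in> carrier (ind_left sA \<Delta>A sC \<pi> \<rho>')"
proof -
  interpret l: left_induction sA \<Delta>A \<epsilon>A sC \<Delta>C \<epsilon>C \<pi> \<rho> by unfold_locales (rule \<rho>)
  interpret l': left_induction sA \<Delta>A \<epsilon>A sC \<Delta>C \<epsilon>C \<pi> \<rho>' by unfold_locales (rule \<rho>')
  let ?T = "tensor_map sA l.sV sA l'.sV id T"
  let ?T' = "tensor_map sA fscale sA fscale id (tensor_map sC l.sV sC l'.sV id T)"
  note T_lins = l.map_lins l'.map_lins T T[THEN linear_comp]
  note T_simps = l.map_simps l'.map_simps T
  have F': "F \<in> tensor_space sA UNIV l.sV l.V" and eq: "l.by_translation F = l.by_coaction F"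
    using F by (auto simp: l.carrier_ind)
  have "\<forall>F\<in>tensor_space sA UNIV l.sV l.V. l'.by_translation (?T F) = ?T' (l.by_translation F)"
  proof (rule tensor_space_ext)
    fix a v
    have "\<forall>X\<in>tensor_space sA UNIV sC UNIV.
        tensor_assoc sA sC l'.sV (tens fscale l'.sV X (T v)) =
        ?T' (tensor_assoc sA sC l.sV (tens fscale l.sV X v))"
      by (rule tensor_space_ext) ((intro T_lins)+, simp add: T_simps)
    then show "l'.by_translation (?T (tens sA l.sV a v)) = ?T' (l.by_translation (tens sA l.sV a v))"
      using right_translation_in[of a] by (simp add: T_simps del: o_apply)
  qed (intro T_lins)+
  moreover have "\<forall>F\<in>tensor_space sA UNIV l.sV l.V. l'.by_coaction (?T F) = ?T' (l.by_coaction F)"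
    by (rule tensor_space_ext) ((intro T_lins)+, simp add: T_simps intertwines)
  ultimately have "l'.by_translation (?T F) = l'.by_coaction (?T F)" using F' eq by simp
  moreover have "?T F \<in> tensor_space sA UNIV l'.sV l'.V"
    by (rule tensor_map_maps_tensor_space[OF _ T F']) (auto intro: into T_lins)
  ultimately show ?thesis by (simp add: l'.carrier_ind)
qed

lemma left_intertwiner_ind_coaction:
  assumes \<rho>: "left_corepresentation sC \<Delta>C \<epsilon>C \<rho>" and \<rho>': "left_corepresentation sC \<Delta>C \<epsilon>C \<rho>'"
    and T: "Vector_Spaces.linear (scalar \<rho>) (scalar \<rho>') T"
    and F: "F \<in> carrier (ind_left sA \<Delta>A sC \<pi> \<rho>)"
  shows "coaction (ind_left sA \<Delta>A sC \<pi> \<rho>') (tensor_map sA (scalar \<rho>) sA (scalar \<rho>') id T F) =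
    tensor_map sA fscale sA fscale id (tensor_map sA (scalar \<rho>) sA (scalar \<rho>') id T)
      (coaction (ind_left sA \<Delta>A sC \<pi> \<rho>) F)"
proof -
  interpret l: left_induction sA \<Delta>A \<epsilon>A sC \<Delta>C \<epsilon>C \<pi> \<rho> by unfold_locales (rule \<rho>)
  interpret l': left_induction sA \<Delta>A \<epsilon>A sC \<Delta>C \<epsilon>C \<pi> \<rho>' by unfold_locales (rule \<rho>')
  let ?T = "tensor_map sA l.sV sA l'.sV id T"
  note T_lins = l.map_lins l'.map_lins T T[THEN linear_comp]
  note T_simps = l.map_simps l'.map_simps T
  have "\<forall>F\<in>tensor_space sA UNIV l.sV l.V.
      l'.ind_coaction (?T F) = tensor_map sA fscale sA fscale id ?T (l.ind_coaction F)"
  proof (rule tensor_space_ext)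
    fix a v
    have "\<forall>X\<in>tensor_space sA UNIV sA UNIV.
        tensor_assoc sA sA l'.sV (tens fscale l'.sV X (T v)) =
        tensor_map sA fscale sA fscale id ?T (tensor_assoc sA sA l.sV (tens fscale l.sV X v))"
      by (rule tensor_space_ext) ((intro T_lins)+, simp add: T_simps)
    then show "l'.ind_coaction (?T (tens sA l.sV a v)) =
        tensor_map sA fscale sA fscale id ?T (l.ind_coaction (tens sA l.sV a v))"
      by (simp add: T_simps A.comult_in)
  qed (intro T_lins)+
  then show ?thesis using F by (simp add: l.carrier_ind l.coaction_ind l'.coaction_ind)
qed

theorem equivalent_left_coreps_ind:
  assumes "equivalent_left_coreps sC \<Delta>C \<epsilon>C \<rho> \<rho>'"
  shows "equivalent_left_coreps sA \<Delta>A \<epsilon>A (ind_left sA \<Delta>A sC \<pi> \<rho>) (ind_left sA \<Delta>A sC \<pi> \<rho>')"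
proof -
  obtain T where \<rho>: "left_corepresentation sC \<Delta>C \<epsilon>C \<rho>" and \<rho>': "left_corepresentation sC \<Delta>C \<epsilon>C \<rho>'"
    and T: "Vector_Spaces.linear (scalar \<rho>) (scalar \<rho>') T"
    and bij: "bij_betw T (carrier \<rho>) (carrier \<rho>')"
    and T_int: "\<And>v. v \<in> carrier \<rho> \<Longrightarrow>
      coaction \<rho>' (T v) = tensor_map sC (scalar \<rho>) sC (scalar \<rho>') id T (coaction \<rho> v)"
    using assms unfolding equivalent_left_coreps_def by blast
  interpret l: left_induction sA \<Delta>A \<epsilon>A sC \<Delta>C \<epsilon>C \<pi> \<rho> by unfold_locales (rule \<rho>)
  interpret l': left_induction sA \<Delta>A \<epsilon>A sC \<Delta>C \<epsilon>C \<pi> \<rho>' by unfold_locales (rule \<rho>')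
  have "module.subspace l.sV l.V" using \<rho> by (simp add: left_corepresentation_def)
  then obtain g where g: "Vector_Spaces.linear l'.sV l.sV g"
    and gT: "\<And>v. v \<in> l.V \<Longrightarrow> g (T v) = v" and g_in: "\<And>w. w \<in> l'.V \<Longrightarrow> g w \<in> l.V"
    and Tg: "\<And>w. w \<in> l'.V \<Longrightarrow> T (g w) = w"
    using linear_bij_betw_inverse[OF T _ bij] by blast
  have T_in: "T v \<in> l'.V" if "v \<in> l.V" for v using bij that by (auto simp: bij_betw_def)
  \<comment> \<open>The inverse intertwines as well: apply it to the equation for \<open>T\<close> at \<open>g w\<close>.\<close>
  have g_int: "coaction \<rho> (g w) = tensor_map sC l'.sV sC l.sV id g (coaction \<rho>' w)"
    if w: "w \<in> l'.V" for w
  proof -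
    have "coaction \<rho>' w = tensor_map sC l.sV sC l'.sV id T (coaction \<rho> (g w))"
      using T_int[OF g_in[OF w]] Tg[OF w] by simp
    moreover have "tensor_map sC l'.sV sC l.sV id g (tensor_map sC l.sV sC l'.sV id T (coaction \<rho> (g w))) =
        coaction \<rho> (g w)"
      by (rule tensor_map_inverse[OF _ _ T g _ gT l.coaction_in[OF g_in[OF w]]])
        (simp_all add: linear_id vector_spaces)
    ultimately show ?thesis by simp
  qed
  let ?T = "tensor_map sA l.sV sA l'.sV id T" and ?g = "tensor_map sA l'.sV sA l.sV id g"
  have "bij_betw ?T (carrier l.ind) (carrier l'.ind)"
  proof (rule bij_betw_byWitness[where f' = ?g])
    show "\<forall>F\<in>carrier l.ind. ?g (?T F) = F"
    proof
      fix F assume "F \<in> carrier l.ind"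
      then have F: "F \<in> tensor_space sA UNIV l.sV l.V" by (simp add: l.carrier_ind)
      show "?g (?T F) = F"
        by (rule tensor_map_inverse[OF _ _ T g _ gT F]) (simp_all add: linear_id vector_spaces)
    qed
    show "\<forall>F\<in>carrier l'.ind. ?T (?g F) = F"
    proof
      fix F assume "F \<in> carrier l'.ind"
      then have F: "F \<in> tensor_space sA UNIV l'.sV l'.V" by (simp add: l'.carrier_ind)
      show "?T (?g F) = F"
        by (rule tensor_map_inverse[OF _ _ g T _ Tg F]) (simp_all add: linear_id vector_spaces)
    qed
    show "?T ` carrier l.ind \<subseteq> carrier l'.ind"
      using left_intertwiner_maps_ind[OF \<rho> \<rho>' T T_in T_int] by blast
    show "?g ` carrier l'.ind \<subseteq> carrier l.ind"
      using left_intertwiner_maps_ind[OF \<rho>' \<rho> g g_in g_int] by blast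
  qed
  moreover have "Vector_Spaces.linear fscale fscale ?T"
    by (intro linear_tensor_map T linear_id vector_spaces)
  ultimately show ?thesis
    unfolding equivalent_left_coreps_def l.scalar_ind l'.scalar_ind
    using l.left_corepresentation_ind l'.left_corepresentation_ind
      left_intertwiner_ind_coaction[OF \<rho> \<rho>' T] by blast
qed

end

theorem proposition3p6:
  fixes sA :: "'k::field_char_0 \<Rightarrow> 'a::ring_1 \<Rightarrow> 'a"
    and \<Delta>A :: "'a \<Rightarrow> ('a, 'a, 'k) tensor" and \<epsilon>A :: "'a \<Rightarrow> 'k" and S :: "'a \<Rightarrow> 'a"
    and sC :: "'k \<Rightarrow> 'c::ab_group_add \<Rightarrow> 'c"
    and \<Delta>C :: "'c \<Rightarrow> ('c, 'c, 'k) tensor" and \<epsilon>C :: "'c \<Rightarrow> 'k" and \<pi> :: "'a \<Rightarrow> 'c"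
    and lact :: "'a \<Rightarrow> 'c \<Rightarrow> 'c" and ract :: "'c \<Rightarrow> 'a \<Rightarrow> 'c"
    and \<rho>R :: "('k, 'v::ab_group_add, ('v, 'c, 'k) tensor) corep"
    and \<rho>R' :: "('k, 'w::ab_group_add, ('w, 'c, 'k) tensor) corep"
    and \<rho>L :: "('k, 'x::ab_group_add, ('c, 'x, 'k) tensor) corep"
    and \<rho>L' :: "('k, 'y::ab_group_add, ('c, 'y, 'k) tensor) corep"
  assumes "hopf_algebra sA \<Delta>A \<epsilon>A S"
    and "left_coisotropic_subgroup sA \<Delta>A \<epsilon>A S sC \<Delta>C \<epsilon>C \<pi> lact \<or>
         right_coisotropic_subgroup sA \<Delta>A \<epsilon>A S sC \<Delta>C \<epsilon>C \<pi> ract"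
  shows "(equivalent_right_coreps sC \<Delta>C \<epsilon>C \<rho>R \<rho>R' \<longrightarrow>
            equivalent_right_coreps sA \<Delta>A \<epsilon>A
              (ind_right sA \<Delta>A sC \<pi> \<rho>R) (ind_right sA \<Delta>A sC \<pi> \<rho>R')) \<and>
         (equivalent_left_coreps sC \<Delta>C \<epsilon>C \<rho>L \<rho>L' \<longrightarrow>
            equivalent_left_coreps sA \<Delta>A \<epsilon>A
              (ind_left sA \<Delta>A sC \<pi> \<rho>L) (ind_left sA \<Delta>A sC \<pi> \<rho>L'))"
proof -
  have "coalgebra_epimorphism sA \<Delta>A \<epsilon>A sC \<Delta>C \<epsilon>C \<pi>"
    using assms(2)
    by (auto simp: left_coisotropic_subgroup_def right_coisotropic_subgroup_def)
  then interpret coalgebra_epimorphism sA \<Delta>A \<epsilon>A sC \<Delta>C \<epsilon>C \<pi> .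
  show ?thesis using equivalent_right_coreps_ind equivalent_left_coreps_ind by blast
qed

end
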